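(* Fix $r_0\in(0,\tfrac23)$, $\alpha\in[0,1)$, and $(\lambda,\mu)\in(0,a_0]^2$ with $a_0=a_0(r_0)$ as in the existence theorem stated in the context. For every $\varepsilon\in(0,1)$ let $(u_\varepsilon,v_\varepsilon,\varphi_\varepsilon)$ be a solution of $(\mathrm P_{\varepsilon,\lambda,\mu})$ having all the properties listed in that existence theorem (regularity, evenness, convexity of $u_\varepsilon$ and $-v_\varepsilon$, $|\partial_x^2u_\varepsilon|,|\partial_x^2v_\varepsilon|\le r_0$, the bounds $0\ge u_\varepsilon\ge-\frac13+\kappa_0$, $-\frac13-2\kappa_0\ge v_\varepsilon\ge -1$ with $\kappa_0\in(0,\frac13)$ independent of $\varepsilon$, and $\|u_\varepsilon\|_{W^2_\infty},\|v_\varepsilon\|_{W^2_\infty}\le3$). Then there exist a null sequence $(\varepsilon_k)_{k\ge1}\subset(0,1)$ and functions $u_0,v_0\in W^2_\infty(-1,1)$ solving the small aspect ratio equations $$u_0''=\frac{\lambda}{(u_0-v_0)^2},\quad u_0(\pm1)=0,\qquad v_0''=-\frac{\mu}{(u_0-v_0)^2},\quad v_0(\pm1)=-1,$$ on $(-1,1)$, with $v_0<u_0$, such that $u_{\varepsilon_k}\to u_0$ and $v_{\varepsilon_k}\to v_0$ in $W^1_\infty(-1,1)$ and $$\varphi_{\varepsilon_k}\mathbf 1_{\Omega_{u_{\varepsilon_k},v_{\varepsilon_k}}}\to\varphi_0\mathbf 1_{\Omega_{u_0,v_0}}\quad\text{in }L_2((-1,1)\times(-1,0))$$ as $k\to\infty$,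 where $\varphi_0(x,z)=\frac{z-v_0(x)}{u_0(x)-v_0(x)}$.
   Context: For functions $u,v\in W^2_\infty(-1,1)$ with $v<u$ on $[-1,1]$, let $\Omega_{u,v}=\{(x,z)\in(-1,1)\times\mathbb R:\ v(x)<z<u(x)\}$, $\Gamma_u=\{(x,u(x)):x\in(-1,1)\}$ and $\Gamma_v=\{(x,v(x)):x\in(-1,1)\}$. For $\varepsilon>0$ write $\nabla_\varepsilon=(\varepsilon\partial_x,\partial_z)$ and $\Delta_\varepsilon=\varepsilon^2\partial_x^2+\partial_z^2$. For parameters $\varepsilon,\lambda,\mu>0$, the problem $(\mathrm P_{\varepsilon,\lambda,\mu})$ consists in finding $(u,v,\varphi)$ with $u,v\in W^2_\infty(-1,1)$, $v<u$, and $\varphi$ on $\overline{\Omega_{u,v}}$ such that $\Delta_\varepsilon\varphi=0$ in $\Omega_{u,v}$; $\varphi(x,z)=\frac{z-v(x)}{u(x)-v(x)}$ on $\partial\Omega_{u,v}$; $\partial_x^2u(x)=\lambda\,|\nabla_\varepsilon\varphi(x,u(x))|^2$ for $x\in(-1,1)$; $\partial_x^2v(x)=-\mu\,|\nabla_\varepsilon\varphi(x,v(x))|^2$ for $x\in(-1,1)$; $u(\pm1)=0$; $v(\pm1)=-1$. Existence theorem (assumed): for every $\varepsilon\in(0,1)$, $r_0\in(0,\frac23)$, $\alpha\in[0,1)$ there is $a_0=a_0(r_0)>0$ such that for every $(\lambda,\mu)\in(0,a_0]^2$ the problem $(\mathrm P_{\varepsilon,\lambda,\mu})$ has a solution with $u,v\in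 C^{2+\alpha}([-1,1])$, $\varphi\in W^2_2(\Omega_{u,v})\cap C(\overline{\Omega_{u,v}})\cap C^{2+\alpha}(\Omega_{u,v}\cup\Gamma_u\cup\Gamma_v)$ and the properties listed in the claim. $\mathbf 1_A$ denotes the characteristic function of $A\subset\mathbb R^2$; functions multiplied by $\mathbf 1_A$ are extended by zero outside $A$. *)

theory Defs
  imports "HOL-Analysis.Analysis"
begin

definition Omega :: "(real \<Rightarrow> real) \<Rightarrow> (real \<Rightarrow> real) \<Rightarrow> (real \<times> real) set" where
  "Omega u v = {(x, z). x \<in> {-1<..<1} \<and> v x < z \<and> z < u x}"

definition Gamma :: "(real \<Rightarrow> real) \<Rightarrow> (real \<times> real) set" where
  "Gamma w = {(x, w x) | x. x \<in> {-1<..<1}}"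

definition pdx :: "(real \<times> real) set \<Rightarrow> (real \<times> real \<Rightarrow> real) \<Rightarrow> real \<times> real \<Rightarrow> real" where
  "pdx S f p = frechet_derivative f (at p within S) (1, 0)"

definition pdz :: "(real \<times> real) set \<Rightarrow> (real \<times> real \<Rightarrow> real) \<Rightarrow> real \<times> real \<Rightarrow> real" where
  "pdz S f p = frechet_derivative f (at p within S) (0, 1)"

definition C2a_interval :: "real \<Rightarrow> (real \<Rightarrow> real) \<Rightarrow> bool" where
  "C2a_interval \<alpha> u \<longleftrightarrow>
     (\<exists>u1 u2. (\<forall>x\<in>{-1..1}. (u has_real_derivative u1 x) (at x within {-1..1}) \<and>
                            (u1 has_real_derivative u2 x) (at x within {-1..1})) \<and>
              continuous_on {-1..1} u2 \<and>
              (\<exists>C. \<forall>x\<in>{-1..1}. \<forall>y\<in>{-1..1}. \<bar>u2 x - u2 y\<bar> \<le> C * \<bar>x - y\<bar> powr \<alpha>))"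

definition C2a_2d :: "real \<Rightarrow> (real \<times> real) set \<Rightarrow> (real \<times> real \<Rightarrow> real) \<Rightarrow> bool" where
  "C2a_2d \<alpha> S f \<longleftrightarrow>
     (\<forall>p\<in>S. f differentiable (at p within S) \<and> pdx S f differentiable (at p within S) \<and>
            pdz S f differentiable (at p within S)) \<and>
     (\<forall>g \<in> {pdx S (pdx S f), pdz S (pdx S f), pdx S (pdz S f), pdz S (pdz S f)}.
        continuous_on S g \<and>
        (\<forall>K. compact K \<and> K \<subseteq> S \<longrightarrow>
              (\<exists>C. \<forall>p\<in>K. \<forall>q\<in>K. \<bar>g p - g q\<bar> \<le> C * dist p q powr \<alpha>)))"

definition L2_on :: "(real \<times> real) set \<Rightarrow> (real \<times> real \<Rightarrow> real) \<Rightarrow> bool" where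
  "L2_on S f \<longleftrightarrow> f measurable_on S \<and> (\<lambda>p. (f p)\<^sup>2) integrable_on S"

text \<open>W^2_2(S) for an open set S, for functions which are C^2 in S (so that weak and
  classical derivatives coincide): the function and its partial derivatives up to order 2
  are square integrable.\<close>

definition W22 :: "(real \<times> real) set \<Rightarrow> (real \<times> real \<Rightarrow> real) \<Rightarrow> bool" where
  "W22 S f \<longleftrightarrow> L2_on S f \<and> L2_on S (pdx S f) \<and> L2_on S (pdz S f) \<and>
     L2_on S (pdx S (pdx S f)) \<and> L2_on S (pdz S (pdx S f)) \<and>
     L2_on S (pdx S (pdz S f)) \<and> L2_on S (pdz S (pdz S f))"

text \<open>W^2_infty(-1,1), identified with its continuous representative on [-1,1]:
  continuous on [-1,1], differentiable on (-1,1) with Lipschitz derivative.\<close>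

definition W2inf :: "(real \<Rightarrow> real) \<Rightarrow> bool" where
  "W2inf u \<longleftrightarrow> continuous_on {-1..1} u \<and> (\<forall>x\<in>{-1<..<1}. u differentiable (at x)) \<and>
     (\<exists>L. L-lipschitz_on {-1<..<1} (deriv u))"

text \<open>The W^2_infty(-1,1) norm (for C^2 functions): sum of the sup norms of u, u', u''.\<close>

definition W2inf_norm :: "(real \<Rightarrow> real) \<Rightarrow> real" where
  "W2inf_norm u = (SUP x\<in>{-1<..<1}. \<bar>u x\<bar>) + (SUP x\<in>{-1<..<1}. \<bar>deriv u x\<bar>)
                  + (SUP x\<in>{-1<..<1}. \<bar>deriv (deriv u) x\<bar>)"

definition is_solution_P ::
  "real \<Rightarrow> real \<Rightarrow> real \<Rightarrow> (real \<Rightarrow> real) \<Rightarrow> (real \<Rightarrow> real) \<Rightarrow> (real \<times> real \<Rightarrow> real) \<Rightarrow> bool" where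
  "is_solution_P \<epsilon> lam mu u v \<phi> \<longleftrightarrow>
     (let \<Omega> = Omega u v; S = Omega u v \<union> Gamma u \<union> Gamma v in
      W2inf u \<and> W2inf v \<and> (\<forall>x\<in>{-1..1}. v x < u x) \<and>
      (\<forall>p\<in>\<Omega>. \<epsilon>\<^sup>2 * pdx S (pdx S \<phi>) p + pdz S (pdz S \<phi>) p = 0) \<and>
      (\<forall>p\<in>frontier \<Omega>. \<phi> p = (snd p - v (fst p)) / (u (fst p) - v (fst p))) \<and>
      (\<forall>x\<in>{-1<..<1}. deriv (deriv u) x =
          lam * ((\<epsilon> * pdx S \<phi> (x, u x))\<^sup>2 + (pdz S \<phi> (x, u x))\<^sup>2)) \<and>
      (\<forall>x\<in>{-1<..<1}. deriv (deriv v) x =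
          - mu * ((\<epsilon> * pdx S \<phi> (x, v x))\<^sup>2 + (pdz S \<phi> (x, v x))\<^sup>2)) \<and>
      u (-1) = 0 \<and> u 1 = 0 \<and> v (-1) = -1 \<and> v 1 = -1)"

end

theory Submission
  imports Defs "HOL-Complex_Analysis.Great_Picard"
begin

text \<open>
  Write \<open>D = u - v\<close>, which is bounded below uniformly in \<open>\<epsilon>\<close>. The affine interpolant
  \<open>(z - v x) / D x\<close> solves the equation up to \<open>O(\<epsilon>\<^sup>2)\<close> and has the boundary values of \<open>\<phi>\<close>, while
  for small \<open>\<epsilon>\<close> the function \<open>(z - v x) * (u x - z)\<close> is uniformly superharmonic and vanishes on both
  graphs. The maximum principle bounds the difference of \<open>\<phi>\<close> and the interpolant by
  \<open>K * \<epsilon>\<^sup>2 * (z - v x) * (u x - z)\<close>, hence also the vertical derivatives on the two graphs: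
  they equal \<open>1 / D + O(\<epsilon>\<^sup>2)\<close>. As \<open>\<phi>\<close> is constant on each graph, the horizontal
  derivatives there are bounded, so \<open>u'' = \<lambda> / D\<^sup>2 + O(\<epsilon>\<^sup>2)\<close> and
  \<open>v'' = - \<mu> / D\<^sup>2 + O(\<epsilon>\<^sup>2)\<close> uniformly. Arzela--Ascoli for \<open>(u, u', v, v')\<close> then yields
  the limit equations, and the potentials converge by dominated convergence.
\<close>

section \<open>A minimum principle for the anisotropic Laplacian\<close>

text \<open>At the minimum \<open>f'\<close> vanishes, so a negative \<open>c\<close> would make
  \<open>f'\<close> negative just to the right of \<open>x\<close>, and the mean value theorem would
  then push \<open>f\<close> below its minimum.\<close>

lemma second_derivative_nonneg_at_local_min:
  fixes f f' :: "real \<Rightarrow> real"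
  assumes "0 < d"
    and f: "\<And>y. \<bar>y - x\<bar> < d \<Longrightarrow> (f has_real_derivative f' y) (at y)"
    and f': "(f' has_real_derivative c) (at x)"
    and min: "\<And>y. \<bar>y - x\<bar> < d \<Longrightarrow> f x \<le> f y"
  shows "0 \<le> c"
proof (rule ccontr)
  assume "\<not> 0 \<le> c"
  then obtain \<delta> where "\<delta> > 0" and \<delta>: "\<And>h. 0 < h \<Longrightarrow> h < \<delta> \<Longrightarrow> f' (x + h) < f' x"
    using DERIV_neg_dec_right[OF f'] by (metis not_le)
  have zero: "f' x = 0"
    by (rule DERIV_local_min[OF f \<open>0 < d\<close>])
       (use \<open>0 < d\<close> min in \<open>auto simp: abs_minus_commute\<close>)
  define h where "h = min d \<delta> / 2"
  have h: "0 < h" "h < d" "h < \<delta>"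
    using \<open>0 < d\<close> \<open>\<delta> > 0\<close> by (auto simp: h_def min_def)
  obtain z where z: "x < z" "z < x + h" "f (x + h) - f x = (x + h - x) * f' z"
    using MVT2[of x "x + h" f f'] f h by force
  have "f' z < 0"
    using \<delta>[of "z - x"] z h zero by auto
  then have "f (x + h) < f x"
    using z h by (smt (verit) mult_pos_neg)
  then show False
    using min[of "x + h"] h by auto
qed

text \<open>At an interior minimum both pure second derivatives would be nonnegative, against the
  strict inequality \<open>op\<close>; so the minimum over the compact closure lies on the frontier.
  The derivatives are separate functions taken along coordinate lines, so that explicit formulas can
  be supplied for a comparison function.\<close>

lemma anisotropic_minimum_principle:
  fixes \<psi> \<psi>x \<psi>xx \<psi>z \<psi>zz :: "real \<times> real \<Rightarrow> real"
  assumes "open G" "bounded G"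
    and cont: "continuous_on (closure G) \<psi>"
    and bdry: "\<And>p. p \<in> frontier G \<Longrightarrow> 0 \<le> \<psi> p"
    and x1: "\<And>x z. (x, z) \<in> G \<Longrightarrow> ((\<lambda>t. \<psi> (t, z)) has_real_derivative \<psi>x (x, z)) (at x)"
    and x2: "\<And>x z. (x, z) \<in> G \<Longrightarrow> ((\<lambda>t. \<psi>x (t, z)) has_real_derivative \<psi>xx (x, z)) (at x)"
    and z1: "\<And>x z. (x, z) \<in> G \<Longrightarrow> ((\<lambda>t. \<psi> (x, t)) has_real_derivative \<psi>z (x, z)) (at z)"
    and z2: "\<And>x z. (x, z) \<in> G \<Longrightarrow> ((\<lambda>t. \<psi>z (x, t)) has_real_derivative \<psi>zz (x, z)) (at z)"
    and op: "\<And>p. p \<in> G \<Longrightarrow> a\<^sup>2 * \<psi>xx p + \<psi>zz p < 0"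
    and "p \<in> closure G"
  shows "0 \<le> \<psi> p"
proof -
  have "\<exists>q\<in>closure G. \<forall>y\<in>closure G. \<psi> q \<le> \<psi> y"
    by (rule continuous_attains_inf) (use \<open>bounded G\<close> \<open>p \<in> closure G\<close> cont in auto)
  then obtain q where q: "q \<in> closure G" and min: "\<And>y. y \<in> closure G \<Longrightarrow> \<psi> q \<le> \<psi> y"
    by auto
  have "q \<notin> G"
  proof
    assume "q \<in> G"
    obtain x z where xz: "q = (x, z)"
      by (cases q)
    obtain d where "d > 0" and d: "ball q d \<subseteq> G"
      using \<open>open G\<close> \<open>q \<in> G\<close> by (metis openE)
    have Gx: "(y, z) \<in> G" if "\<bar>y - x\<bar> < d" for y
      using d that by (auto simp: xz dist_Pair_Pair dist_real_def subset_iff abs_minus_commute)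
    have Gz: "(x, y) \<in> G" if "\<bar>y - z\<bar> < d" for y
      using d that by (auto simp: xz dist_Pair_Pair dist_real_def subset_iff abs_minus_commute)
    have minG: "\<psi> (x, z) \<le> \<psi> y" if "y \<in> G" for y
      using min[of y] that closure_subset xz by blast
    have "0 \<le> \<psi>xx (x, z)"
      by (rule second_derivative_nonneg_at_local_min[OF \<open>d > 0\<close>, of x "\<lambda>t. \<psi> (t, z)" "\<lambda>t. \<psi>x (t, z)"])
         (use Gx \<open>q \<in> G\<close> xz minG x1 x2 in auto)
    moreover have "0 \<le> \<psi>zz (x, z)"
      by (rule second_derivative_nonneg_at_local_min[OF \<open>d > 0\<close>, of z "\<lambda>t. \<psi> (x, t)" "\<lambda>t. \<psi>z (x, t)"])
         (use Gz \<open>q \<in> G\<close> xz minG z1 z2 in auto)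
    ultimately have "0 \<le> a\<^sup>2 * \<psi>xx q + \<psi>zz q"
      by (simp add: xz)
    with op[OF \<open>q \<in> G\<close>] show False
      by simp
  qed
  then have "q \<in> frontier G"
    using q \<open>open G\<close> by (simp add: frontier_def interior_open)
  then show ?thesis
    using bdry[of q] min[OF \<open>p \<in> closure G\<close>] by linarith
qed

section \<open>The domain between two graphs and derivatives at its boundary\<close>

lemma open_Omega:
  assumes "continuous_on {-1<..<1} u" "continuous_on {-1<..<1} v"
  shows "open (Omega u v)"
proof -
  let ?S = "{-1<..<1::real} \<times> (UNIV :: real set)"
  have "open ?S"
    by (intro open_Times) auto
  have cu: "continuous_on ?S (\<lambda>p. u (fst p))"
    by (rule continuous_on_compose2[OF assms(1)]) (auto intro!: continuous_intros)
  have cv: "continuous_on ?S (\<lambda>p. v (fst p))"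
    by (rule continuous_on_compose2[OF assms(2)]) (auto intro!: continuous_intros)
  have "open {p \<in> ?S. snd p - v (fst p) \<in> {0<..}}" "open {p \<in> ?S. u (fst p) - snd p \<in> {0<..}}"
    using continuous_open_preimage[of ?S "\<lambda>p. snd p - v (fst p)" "{0<..}"]
      continuous_open_preimage[of ?S "\<lambda>p. u (fst p) - snd p" "{0<..}"] \<open>open ?S\<close> cu cv
    by (simp_all add: continuous_intros Int_def vimage_def)
  moreover have "Omega u v = {p \<in> ?S. snd p - v (fst p) \<in> {0<..}} \<inter> {p \<in> ?S. u (fst p) - snd p \<in> {0<..}}"
    by (auto simp: Omega_def)
  ultimately show ?thesis
    by (simp add: open_Int)
qed

lemma closure_Omega_subset:
  assumes u: "continuous_on {-1..1} u" and v: "continuous_on {-1..1} v"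
  shows "closure (Omega u v) \<subseteq> {(x, z). x \<in> {-1..1} \<and> v x \<le> z \<and> z \<le> u x}"
proof (rule closure_minimal)
  show "Omega u v \<subseteq> {(x, z). x \<in> {-1..1} \<and> v x \<le> z \<and> z \<le> u x}"
    by (auto simp: Omega_def)
  let ?S = "{-1..1::real} \<times> (UNIV :: real set)"
  have cu: "continuous_on ?S (\<lambda>p. u (fst p))"
    by (rule continuous_on_compose2[OF u]) (auto intro!: continuous_intros)
  have cv: "continuous_on ?S (\<lambda>p. v (fst p))"
    by (rule continuous_on_compose2[OF v]) (auto intro!: continuous_intros)
  have "closed ?S"
    by (simp add: closed_Times)
  then have "closed {p \<in> ?S. v (fst p) \<le> snd p}" "closed {p \<in> ?S. snd p \<le> u (fst p)}"
    using continuous_closed_preimage[of ?S "\<lambda>p. snd p - v (fst p)" "{0..}"]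
      continuous_closed_preimage[of ?S "\<lambda>p. u (fst p) - snd p" "{0..}"] cu cv
    by (simp_all add: continuous_intros Int_def vimage_def)
  moreover have "{(x, z). x \<in> {-1..1} \<and> v x \<le> z \<and> z \<le> u x}
      = {p \<in> ?S. v (fst p) \<le> snd p} \<inter> {p \<in> ?S. snd p \<le> u (fst p)}"
    by auto
  ultimately show "closed {(x, z). x \<in> {-1..1} \<and> v x \<le> z \<and> z \<le> u x}"
    by (simp add: closed_Int)
qed

text \<open>The Dirichlet condition is posed on the frontier; this inclusion transfers it to the two
  graphs, each point of which is a limit of points approaching it vertically from inside.\<close>

lemma Gamma_subset_frontier_Omega:
  assumes "\<And>x. x \<in> {-1<..<1} \<Longrightarrow> v x < u x"
  shows "Gamma u \<subseteq> frontier (Omega u v)" "Gamma v \<subseteq> frontier (Omega u v)"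
proof -
  have "(x, u x) \<in> closure (Omega u v) \<and> (x, v x) \<in> closure (Omega u v)" if x: "x \<in> {-1<..<1}" for x
  proof
    \<comment> \<open>With half the gap, \<open>u x - m\<close> and \<open>v x + m\<close> both stay
      strictly between the graphs for \<open>0 < m\<close> and \<open>m \<le> l\<close>, so one null
      sequence of offsets serves both boundary points.\<close>
    define l where "l = (u x - v x) / 2"
    have "l > 0"
      using assms[OF x] by (simp add: l_def)
    have lim: "(\<lambda>n. l * inverse (real (Suc n))) \<longlonglongrightarrow> 0"
      using LIMSEQ_inverse_real_of_nat tendsto_mult_right_zero by blast
    have le: "0 < l * inverse (real (Suc n))" "l * inverse (real (Suc n)) \<le> l" for n
      using \<open>l > 0\<close> by (auto simp: field_simps)
    have "(x, u x - m) \<in> Omega u v" "(x, v x + m) \<in> Omega u v" if "0 < m" "m \<le> l" for m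
      using that assms[OF x] x by (auto simp: Omega_def l_def)
    then have u: "(x, u x - l * inverse (real (Suc n))) \<in> Omega u v"
      and v: "(x, v x + l * inverse (real (Suc n))) \<in> Omega u v" for n
      using le by blast+
    have "(\<lambda>n. (x, u x - l * inverse (real (Suc n)))) \<longlonglongrightarrow> (x, u x - 0)"
         "(\<lambda>n. (x, v x + l * inverse (real (Suc n)))) \<longlonglongrightarrow> (x, v x + 0)"
      by (intro tendsto_intros lim)+
    then show "(x, u x) \<in> closure (Omega u v)" "(x, v x) \<in> closure (Omega u v)"
      using u v unfolding closure_sequential by (metis (lifting) diff_zero add_0_right)+
  qed
  moreover have "(x, u x) \<notin> Omega u v" "(x, v x) \<notin> Omega u v" for x
    by (auto simp: Omega_def)
  ultimately show "Gamma u \<subseteq> frontier (Omega u v)" "Gamma v \<subseteq> frontier (Omega u v)"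
    using interior_subset by (fastforce simp: Gamma_def frontier_def)+
qed

text \<open>At a boundary point the one-sided vertical difference quotient and the derivative along the
  boundary curve determine both partial derivatives.\<close>

lemma boundary_partials:
  fixes f :: "real \<times> real \<Rightarrow> real"
  assumes diff: "f differentiable (at (x, w x) within S)"
    and x: "x \<in> {-1<..<1}"
    and curve: "\<And>t. t \<in> {-1<..<1} \<Longrightarrow> (t, w t) \<in> S \<and> f (t, w t) = c"
    and w: "(w has_real_derivative w') (at x)"
    and "s \<in> {-1, 1 :: real}" "0 < \<delta>"
    and vert: "\<And>t. 0 < t \<Longrightarrow> t < \<delta> \<Longrightarrow>
      (x, w x + s * t) \<in> S \<and> \<bar>f (x, w x + s * t) - c - s * t * g\<bar> \<le> K * t"
  shows "pdx S f (x, w x) = - w' * pdz S f (x, w x)" "\<bar>pdz S f (x, w x) - g\<bar> \<le> K"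
proof -
  let ?F = "frechet_derivative f (at (x, w x) within S)"
  have F: "(f has_derivative ?F) (at (x, w x) within S)"
    using diff frechet_derivative_works by blast
  interpret F: linear ?F
    using F has_derivative_linear by blast
  have F_eq: "?F (a, b) = a * pdx S f (x, w x) + b * pdz S f (x, w x)" for a b
  proof -
    have "(a, b) = a *\<^sub>R (1, 0) + b *\<^sub>R (0, 1)"
      by simp
    then show ?thesis
      unfolding pdx_def pdz_def by (metis F.add F.scaleR real_scaleR_def)
  qed

  \<comment> \<open>As \<open>f\<close> equals \<open>c\<close> along the graph, its derivative in
    the tangent direction \<open>(1, w')\<close> vanishes; this expresses the horizontal partial
    through the vertical one.\<close>
  have "((\<lambda>t. (t, w t)) has_derivative (\<lambda>h. (h, w' * h))) (at x within {-1<..<1})"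
    using w by (intro derivative_intros) (auto simp: has_field_derivative_def intro: has_derivative_at_withinI)
  moreover have "(f has_derivative ?F) (at (x, w x) within (\<lambda>t. (t, w t)) ` {-1<..<1})"
    by (rule has_derivative_subset[OF F]) (use curve in auto)
  ultimately have "((\<lambda>t. f (t, w t)) has_derivative (\<lambda>h. ?F (h, w' * h))) (at x within {-1<..<1})"
    by (rule has_derivative_in_compose)
  then have "((\<lambda>t. c) has_derivative (\<lambda>h. ?F (h, w' * h))) (at x within {-1<..<1})"
    by (rule has_derivative_transform[OF x, rotated]) (use curve in auto)
  then have "((\<lambda>t. c) has_derivative (\<lambda>h. ?F (h, w' * h))) (at x)"
    by (simp only: at_within_open[OF x open_greaterThanLessThan])
  then have "(\<lambda>h. ?F (h, w' * h)) = (\<lambda>h. 0)"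
    by (rule has_derivative_unique) simp
  from fun_cong[OF this, of 1] have "?F (1, w' * 1) = 0"
    by simp
  then show "pdx S f (x, w x) = - w' * pdz S f (x, w x)"
    by (simp add: F_eq)

  \<comment> \<open>The vertical segment leaves the boundary point into the domain, downwards for
    \<open>s = -1\<close> and upwards for \<open>s = 1\<close>. The parameter 0 belongs to the
    interval, so the chain rule gives a one-sided derivative, equal to \<open>s\<close> times the
    vertical partial.\<close>
  let ?I = "{0..<\<delta>}"
  have "((\<lambda>t. (x, w x + s * t)) has_derivative (\<lambda>h. (0, s * h))) (at 0 within ?I)"
    by (auto intro!: derivative_eq_intros)
  moreover have "(f has_derivative ?F) (at (x, w x + s * 0) within (\<lambda>t. (x, w x + s * t)) ` ?I)"
  proof -
    have "(\<lambda>t. (x, w x + s * t)) ` ?I \<subseteq> S"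
      using vert curve[OF x] by (force simp: less_le)
    then show ?thesis
      using has_derivative_subset[OF F] by simp
  qed
  ultimately have "((\<lambda>t. f (x, w x + s * t)) has_derivative (\<lambda>h. ?F (0, s * h))) (at 0 within ?I)"
    by (rule has_derivative_in_compose)
  then have "((\<lambda>t. f (x, w x + s * t)) has_real_derivative s * pdz S f (x, w x)) (at 0 within ?I)"
    by (simp add: F_eq has_field_derivative_def mult_ac mult_commute_abs)
  then have lim: "((\<lambda>t. (f (x, w x + s * t) - c) / t) \<longlongrightarrow> s * pdz S f (x, w x)) (at 0 within ?I)"
    using curve[OF x] by (simp add: has_field_derivative_iff)
  have nt: "at 0 within ?I \<noteq> bot"
    using \<open>0 < \<delta>\<close> by (simp add: trivial_limit_within islimpt_Ico)
  have "\<forall>\<^sub>F t in at 0 within ?I. \<bar>(f (x, w x + s * t) - c) / t - s * g\<bar> \<le> K"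
    unfolding eventually_at
  proof (intro exI[of _ 1] conjI ballI impI)
    fix t assume t: "t \<in> ?I" "t \<noteq> 0 \<and> dist t 0 < 1"
    then have "(f (x, w x + s * t) - c) / t - s * g = (f (x, w x + s * t) - c - s * t * g) / t"
      by (simp add: field_simps)
    then show "\<bar>(f (x, w x + s * t) - c) / t - s * g\<bar> \<le> K"
      using vert[of t] t by (simp add: abs_divide divide_le_eq)
  qed simp
  moreover have "((\<lambda>t. \<bar>(f (x, w x + s * t) - c) / t - s * g\<bar>) \<longlongrightarrow> \<bar>s * pdz S f (x, w x) - s * g\<bar>) (at 0 within ?I)"
    by (intro tendsto_intros lim)
  ultimately have "\<bar>s * pdz S f (x, w x) - s * g\<bar> \<le> K"
    using nt tendsto_upperbound by blast
  then show "\<bar>pdz S f (x, w x) - g\<bar> \<le> K"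
    using \<open>s \<in> {-1, 1}\<close> by auto
qed

section \<open>Uniform bounds for the profiles\<close>

text \<open>The bounds are absolute, so that they hold along a whole family: 1 covers
  \<open>r0 < 2/3\<close>, and 2 is the length of the interval. Derivatives are required in the open
  interval, while the Lipschitz bounds reach the endpoints, as compactness on the closed interval
  demands.\<close>

definition C2_profile :: "(real \<Rightarrow> real) \<Rightarrow> (real \<Rightarrow> real) \<Rightarrow> (real \<Rightarrow> real) \<Rightarrow> bool" where
  "C2_profile w w1 w2 \<longleftrightarrow>
     (\<forall>x\<in>{-1<..<1}. (w has_real_derivative w1 x) (at x) \<and> (w1 has_real_derivative w2 x) (at x) \<and> \<bar>w2 x\<bar> \<le> 1) \<and>
     (\<forall>x\<in>{-1..1}. \<bar>w1 x\<bar> \<le> 2) \<and>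
     (\<forall>x\<in>{-1..1}. \<forall>y\<in>{-1..1}. \<bar>w x - w y\<bar> \<le> 2 * \<bar>x - y\<bar> \<and> \<bar>w1 x - w1 y\<bar> \<le> \<bar>x - y\<bar>)"

lemma C2_profileD:
  assumes "C2_profile w w1 w2"
  shows "x \<in> {-1<..<1} \<Longrightarrow> (w has_real_derivative w1 x) (at x)"
    and "x \<in> {-1<..<1} \<Longrightarrow> (w1 has_real_derivative w2 x) (at x)"
    and "x \<in> {-1<..<1} \<Longrightarrow> \<bar>w2 x\<bar> \<le> 1"
    and "x \<in> {-1..1} \<Longrightarrow> \<bar>w1 x\<bar> \<le> 2"
    and "x \<in> {-1..1} \<Longrightarrow> y \<in> {-1..1} \<Longrightarrow> \<bar>w x - w y\<bar> \<le> 2 * \<bar>x - y\<bar>"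
    and "x \<in> {-1..1} \<Longrightarrow> y \<in> {-1..1} \<Longrightarrow> \<bar>w1 x - w1 y\<bar> \<le> \<bar>x - y\<bar>"
  using assms unfolding C2_profile_def by blast+

lemma continuous_on_C2_profile:
  assumes "C2_profile w w1 w2"
  shows "continuous_on {-1..1} w"
proof (rule lipschitz_on_continuous_on)
  show "2-lipschitz_on {-1..1} w"
    using C2_profileD(5)[OF assms] by (auto simp: lipschitz_on_def dist_real_def)
qed

text \<open>Equal end values give \<open>w1\<close> a zero by Rolle. The bound on the second
  derivative makes \<open>w1\<close> 1-Lipschitz on an interval of length 2, hence bounded by 2, and
  \<open>w\<close> in turn 2-Lipschitz.\<close>

lemma C2a_interval_profile:
  fixes w :: "real \<Rightarrow> real"
  assumes "C2a_interval \<alpha> w" "w (-1) = w 1"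
    and second: "\<And>x. x \<in> {-1<..<1} \<Longrightarrow> \<bar>deriv (deriv w) x\<bar> \<le> 1"
  obtains w1 w2 where "C2_profile w w1 w2" "\<And>x. x \<in> {-1<..<1} \<Longrightarrow> deriv (deriv w) x = w2 x"
proof -
  obtain w1 w2 where
    w1: "\<And>x. x \<in> {-1..1} \<Longrightarrow> (w has_real_derivative w1 x) (at x within {-1..1})" and
    w2: "\<And>x. x \<in> {-1..1} \<Longrightarrow> (w1 has_real_derivative w2 x) (at x within {-1..1})"
    using assms(1) unfolding C2a_interval_def by blast
  have at: "at x within {-1..1} = at x" if "x \<in> {-1<..<1}" for x :: real
    using that by (intro at_within_Icc_at) auto
  have d1: "(w has_real_derivative w1 x) (at x)" and d2: "(w1 has_real_derivative w2 x) (at x)"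
    if "x \<in> {-1<..<1}" for x
    using w1[of x] w2[of x] that at[OF that] by auto
  have "deriv w x = w1 x" if "x \<in> {-1<..<1}" for x
    using d1[OF that] by (rule DERIV_imp_deriv)
  then have "(deriv w has_real_derivative w2 x) (at x)" if "x \<in> {-1<..<1}" for x
    by (intro has_field_derivative_transform_within_open[OF d2[OF that] open_greaterThanLessThan that]) simp
  then have dd: "deriv (deriv w) x = w2 x" if "x \<in> {-1<..<1}" for x
    using that by (auto intro: DERIV_imp_deriv)
  then have b2: "\<bar>w2 x\<bar> \<le> 1" if "x \<in> {-1<..<1}" for x
    using second that by metis
  have cont: "continuous_on {-1..1} w" "continuous_on {-1..1} w1"
    by (rule DERIV_continuous_on[OF w1] DERIV_continuous_on[OF w2]; assumption)+
  \<comment> \<open>Used first for \<open>w1\<close> with constant 1 and then, once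
    \<open>w1\<close> is bounded, for \<open>w\<close> with constant 2.\<close>
  have mean_value: "\<bar>f x - f y\<bar> \<le> C * \<bar>x - y\<bar>"
    if f: "continuous_on {-1..1} f" "\<And>x. x \<in> {-1<..<1} \<Longrightarrow> (f has_real_derivative f' x) (at x)"
      and f': "\<And>x. x \<in> {-1<..<1} \<Longrightarrow> \<bar>f' x\<bar> \<le> C"
      and xy: "x \<in> {-1..1}" "y \<in> {-1..1}" for f f' :: "real \<Rightarrow> real" and C x y
  proof -
    have *: "\<bar>f b - f a\<bar> \<le> C * (b - a)" if "a < b" "a \<in> {-1..1}" "b \<in> {-1..1}" for a b
    proof -
      have "\<exists>l z. a < z \<and> z < b \<and> DERIV f z :> l \<and> f b - f a = (b - a) * l"
      proof (rule MVT[OF \<open>a < b\<close>])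
        show "continuous_on {a..b} f"
          using f(1) by (rule continuous_on_subset) (use that in auto)
        show "f differentiable (at x)" if "a < x" "x < b" for x
          using f(2)[of x] that \<open>a \<in> _\<close> \<open>b \<in> _\<close> real_differentiable_def by auto
      qed
      then obtain l z where z: "a < z" "z < b" "DERIV f z :> l" "f b - f a = (b - a) * l"
        by blast
      then have zI: "z \<in> {-1<..<1}"
        using that by auto
      have "l = f' z"
        using DERIV_unique[OF z(3) f(2)[OF zI]] .
      then show ?thesis
        using z(4) f'[OF zI] \<open>a < b\<close> by (simp add: abs_mult mult.commute mult_right_mono)
    qed
    show ?thesis
      using *[of x y] *[of y x] xy by (cases x y rule: linorder_cases) (auto simp: abs_minus_commute)
  qed
  have lip1: "\<bar>w1 x - w1 y\<bar> \<le> 1 * \<bar>x - y\<bar>" if "x \<in> {-1..1}" "y \<in> {-1..1}" for x y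
    by (rule mean_value[OF cont(2) d2 b2 that])
  have "\<exists>z. -1 < z \<and> z < 1 \<and> (*) (w1 z) = (\<lambda>v. 0)"
    by (rule Rolle_deriv[OF _ assms(2) cont(1)]) (use d1 in \<open>auto simp: has_field_derivative_def\<close>)
  then obtain z where z: "-1 < z" "z < 1" "(*) (w1 z) = (\<lambda>v. 0)"
    by blast
  from fun_cong[OF z(3), of 1] have "w1 z = 0"
    by simp
  then have b1: "\<bar>w1 x\<bar> \<le> 2" if "x \<in> {-1..1}" for x
    using lip1[of x z] z that by auto
  have lip: "\<bar>w x - w y\<bar> \<le> 2 * \<bar>x - y\<bar>" if "x \<in> {-1..1}" "y \<in> {-1..1}" for x y
    by (rule mean_value[OF cont(1) d1 _ that]) (use b1 in auto)
  show thesis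
    by (rule that[of w1 w2, OF _ dd]) (use d1 d2 b2 b1 lip lip1 in \<open>auto simp: C2_profile_def\<close>)
qed

section \<open>The barrier for the potential\<close>

text \<open>\<open>pdx\<close> is a Frechet derivative within \<open>S\<close>, which in the
  application contains boundary points. Around a point of an open subset of \<open>S\<close> the
  restriction to \<open>S\<close> is invisible, so \<open>pdx\<close>, and likewise
  \<open>pdz\<close>, is an ordinary derivative along a coordinate line, as the minimum principle
  expects.\<close>

lemma has_real_derivative_pdx:
  assumes "f differentiable (at (x, z) within S)" "open G" "(x, z) \<in> G" "G \<subseteq> S"
  shows "((\<lambda>t. f (t, z)) has_real_derivative pdx S f (x, z)) (at x)"
proof -
  let ?F = "frechet_derivative f (at (x, z) within S)"
  have "at (x, z) within S = at (x, z)"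
    using assms(2-4) by (intro at_within_interior) (auto intro: interiorI)
  then have F: "(f has_derivative ?F) (at (x, z))"
    using assms(1) frechet_derivative_works by metis
  interpret F: linear ?F
    using F has_derivative_linear by blast
  have "((\<lambda>t. (t, z)) has_derivative (\<lambda>h. (h, 0))) (at x)"
    by (auto intro!: derivative_eq_intros)
  from has_derivative_compose[OF this F]
  have "((\<lambda>t. f (t, z)) has_derivative (\<lambda>h. ?F (h, 0))) (at x)" .
  moreover have "?F (h, 0) = pdx S f (x, z) * h" for h
    using F.scaleR[of h "(1, 0)"] by (simp add: pdx_def)
  ultimately show ?thesis
    by (simp add: has_field_derivative_def)
qed

lemma has_real_derivative_pdz:
  assumes "f differentiable (at (x, z) within S)" "open G" "(x, z) \<in> G" "G \<subseteq> S"
  shows "((\<lambda>t. f (x, t)) has_real_derivative pdz S f (x, z)) (at z)"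
proof -
  let ?F = "frechet_derivative f (at (x, z) within S)"
  have "at (x, z) within S = at (x, z)"
    using assms(2-4) by (intro at_within_interior) (auto intro: interiorI)
  then have F: "(f has_derivative ?F) (at (x, z))"
    using assms(1) frechet_derivative_works by metis
  interpret F: linear ?F
    using F has_derivative_linear by blast
  have "((\<lambda>t. (x, t)) has_derivative (\<lambda>h. (0, h))) (at z)"
    by (auto intro!: derivative_eq_intros)
  from has_derivative_compose[OF this F]
  have "((\<lambda>t. f (x, t)) has_derivative (\<lambda>h. ?F (0, h))) (at z)" .
  moreover have "?F (0, h) = pdz S f (x, z) * h" for h
    using F.scaleR[of h "(0, 1)"] by (simp add: pdz_def)
  ultimately show ?thesis
    by (simp add: has_field_derivative_def)
qed

text \<open>Here \<open>a\<close> and \<open>b\<close> are the first derivatives of \<open>N\<close>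
  and \<open>D\<close>, so the differentiated expression is the quotient rule for
  \<open>N / D\<close>. The result is sorted by powers of \<open>1 / D\<close> to allow a bound term
  by term.\<close>

lemma quotient_second_derivative:
  fixes N D a b :: "real \<Rightarrow> real"
  assumes "(N has_real_derivative a x) (at x)" "(D has_real_derivative b x) (at x)"
    and "(a has_real_derivative a') (at x)" "(b has_real_derivative b') (at x)" "D x \<noteq> 0"
  shows "((\<lambda>t. (a t * D t - N t * b t) / (D t)\<^sup>2) has_real_derivative
    a' / D x - 2 * a x * b x / (D x)\<^sup>2 + N x * (2 * (b x)\<^sup>2 / D x ^ 3 - b' / (D x)\<^sup>2)) (at x)"
proof -
  have "((\<lambda>t. (a t * D t - N t * b t) / (D t)\<^sup>2) has_real_derivative
    ((a' * D x - N x * b') * (D x)\<^sup>2 - (a x * D x - N x * b x) * (2 * D x * b x)) / ((D x)\<^sup>2 * (D x)\<^sup>2)) (at x)"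
    using assms by (auto intro!: derivative_eq_intros simp: algebra_simps)
  moreover have "((a' * D - N * b') * D\<^sup>2 - (a * D - N * b) * (2 * D * b)) / (D\<^sup>2 * D\<^sup>2)
      = a' / D - 2 * a * b / D\<^sup>2 + N * (2 * b\<^sup>2 / D ^ 3 - b' / D\<^sup>2)" if "D \<noteq> 0" for a b D N :: real
    using that by (simp add: field_simps power2_eq_square power3_eq_cube)
  ultimately show ?thesis
    using \<open>D x \<noteq> 0\<close> by simp
qed

text \<open>Since \<open>D \<le> 1\<close>, every power of \<open>1 / D\<close> up to the third is
  dominated by its cube, and the four terms contribute 1 + 16 + 32 + 2. The bounds on
  \<open>D1\<close> and \<open>D2\<close> are those for differences of two profiles.\<close>

lemma quotient_second_derivative_bound:
  fixes N D d v1 v2 D1 D2 :: real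
  assumes "0 < d" "d \<le> D" "D \<le> 1" "\<bar>N\<bar> \<le> 1" "\<bar>v1\<bar> \<le> 2" "\<bar>v2\<bar> \<le> 1" "\<bar>D1\<bar> \<le> 4" "\<bar>D2\<bar> \<le> 2"
  shows "\<bar>- v2 / D + 2 * v1 * D1 / D\<^sup>2 + N * (2 * D1\<^sup>2 / D^3 - D2 / D\<^sup>2)\<bar> \<le> 51 / d^3"
proof -
  define r where "r = 1 / D"
  have r: "1 \<le> r" "r \<le> 1 / d"
    using assms by (auto simp: r_def field_simps)
  have pows: "r \<le> r^3" "r\<^sup>2 \<le> r^3" "0 \<le> r"
    using r power_increasing[of 1 3 r] power_increasing[of 2 3 r] by auto
  have 1: "\<bar>v2 * r\<bar> \<le> 1 * r^3"
    unfolding abs_mult using assms pows by (intro mult_mono) auto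
  have 2: "\<bar>(2 * v1 * D1) * r\<^sup>2\<bar> \<le> 16 * r^3"
  proof -
    have "\<bar>D1\<bar> * \<bar>v1\<bar> \<le> 4 * 2"
      using assms by (intro mult_mono) auto
    then show ?thesis
      unfolding abs_mult[of _ "r\<^sup>2"] using pows by (intro mult_mono) (auto simp: abs_mult)
  qed
  have 3: "\<bar>N * (2 * D1\<^sup>2) * r^3\<bar> \<le> 32 * r^3"
  proof -
    have "D1\<^sup>2 \<le> 4\<^sup>2"
      using power_mono[OF assms(7), of 2] by simp
    then have "\<bar>N\<bar> * (2 * D1\<^sup>2) \<le> 1 * 32"
      using assms by (intro mult_mono) auto
    then show ?thesis
      unfolding abs_mult[of _ "r^3"] using pows by (intro mult_mono) (auto simp: abs_mult)
  qed
  have 4: "\<bar>N * D2 * r\<^sup>2\<bar> \<le> 2 * r^3"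
  proof -
    have "\<bar>N\<bar> * \<bar>D2\<bar> \<le> 1 * 2"
      using assms by (intro mult_mono) auto
    then show ?thesis
      unfolding abs_mult[of _ "r\<^sup>2"] using pows by (intro mult_mono) (auto simp: abs_mult)
  qed
  have "- v2 / D + 2 * v1 * D1 / D\<^sup>2 + N * (2 * D1\<^sup>2 / D^3 - D2 / D\<^sup>2)
      = - (v2 * r) + (2 * v1 * D1) * r\<^sup>2 + N * (2 * D1\<^sup>2) * r^3 - N * D2 * r\<^sup>2"
    by (simp add: r_def power_divide algebra_simps)
  moreover have "r^3 \<le> 1 / d^3"
    using power_mono[OF r(2), of 3] r by (simp add: power_divide)
  ultimately show ?thesis
    using 1 2 3 4 by linarith
qed

text \<open>Both signs of the difference of \<open>\<phi>\<close> and the affine interpolant are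
  compared with a multiple of the product of the vertical distances to the graphs. Keeping this
  product, instead of a constant, allows division by the distance to a graph and so an estimate of
  derivatives there. The condition \<open>\<epsilon>\<^sup>2 \<le> 1 / 10\<close> lets the vertical
  second derivative -2 of the product outweigh its horizontal one.\<close>

lemma potential_barrier:
  fixes u v u1 u2 v1 v2 :: "real \<Rightarrow> real" and \<phi> :: "real \<times> real \<Rightarrow> real"
  defines "S \<equiv> Omega u v \<union> Gamma u \<union> Gamma v"
  assumes eps: "0 < \<epsilon>" "\<epsilon>\<^sup>2 \<le> 1 / 10" and "0 < d"
    and u: "C2_profile u u1 u2" and v: "C2_profile v v1 v2"
    and gap: "\<And>x. x \<in> {-1..1} \<Longrightarrow> d \<le> u x - v x \<and> u x \<le> 0 \<and> -1 \<le> v x"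
    and reg: "continuous_on (closure (Omega u v)) \<phi>" "C2a_2d \<alpha> S \<phi>"
    and pde: "\<And>p. p \<in> Omega u v \<Longrightarrow> \<epsilon>\<^sup>2 * pdx S (pdx S \<phi>) p + pdz S (pdz S \<phi>) p = 0"
    and bdry: "\<And>p. p \<in> frontier (Omega u v) \<Longrightarrow> \<phi> p = (snd p - v (fst p)) / (u (fst p) - v (fst p))"
    and p: "p \<in> closure (Omega u v)"
  shows "\<bar>\<phi> p - (snd p - v (fst p)) / (u (fst p) - v (fst p))\<bar>
      \<le> 52 / d^3 * \<epsilon>\<^sup>2 * ((snd p - v (fst p)) * (u (fst p) - snd p))"
proof -
  let ?G = "Omega u v"
  \<comment> \<open>The constant 52 exceeds by one the 51 that bounds \<open>Axx\<close>; the slack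
    \<open>- \<epsilon>\<^sup>2 / d^3\<close> makes the differential inequality strict.\<close>
  define K where "K = 52 / d^3 * \<epsilon>\<^sup>2"
  define A where "A = (\<lambda>p. (snd p - v (fst p)) / (u (fst p) - v (fst p)))"
  define Ax where "Ax = (\<lambda>p. (- v1 (fst p) * (u (fst p) - v (fst p))
      - (snd p - v (fst p)) * (u1 (fst p) - v1 (fst p))) / (u (fst p) - v (fst p))\<^sup>2)"
  define Axx where "Axx = (\<lambda>p. - v2 (fst p) / (u (fst p) - v (fst p))
      + 2 * v1 (fst p) * (u1 (fst p) - v1 (fst p)) / (u (fst p) - v (fst p))\<^sup>2
      + (snd p - v (fst p)) * (2 * (u1 (fst p) - v1 (fst p))\<^sup>2 / (u (fst p) - v (fst p))^3
        - (u2 (fst p) - v2 (fst p)) / (u (fst p) - v (fst p))\<^sup>2))"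
  define Az where "Az = (\<lambda>p :: real \<times> real. 1 / (u (fst p) - v (fst p)))"
  define B where "B = (\<lambda>p. (snd p - v (fst p)) * (u (fst p) - snd p))"
  define Bx where "Bx = (\<lambda>p. - v1 (fst p) * (u (fst p) - snd p) + (snd p - v (fst p)) * u1 (fst p))"
  define Bxx where "Bxx = (\<lambda>p. - v2 (fst p) * (u (fst p) - snd p) - 2 * v1 (fst p) * u1 (fst p)
      + (snd p - v (fst p)) * u2 (fst p))"
  define Bz where "Bz = (\<lambda>p. u (fst p) + v (fst p) - 2 * snd p)"
  note cont = continuous_on_C2_profile[OF u] continuous_on_C2_profile[OF v]
    and du = C2_profileD(1,2)[OF u] and dv = C2_profileD(1,2)[OF v]
  have "K > 0"
    using eps \<open>0 < d\<close> by (simp add: K_def)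
  have "open ?G"
    by (rule open_Omega) (use cont in \<open>auto elim: continuous_on_subset\<close>)
  have "?G \<subseteq> {-1..1} \<times> {-1..0}"
  proof
    fix q assume "q \<in> ?G"
    then show "q \<in> {-1..1} \<times> {-1..0}"
      using gap[of "fst q"] by (auto simp: Omega_def)
  qed
  then have "bounded ?G"
    using bounded_subset bounded_Times bounded_closed_interval by metis
  have cl: "fst q \<in> {-1..1}" "v (fst q) \<le> snd q" "snd q \<le> u (fst q)" if "q \<in> closure ?G" for q
    using closure_Omega_subset[OF cont] that by auto
  have GD: "x \<in> {-1<..<1}" "v x < z" "z < u x" if "(x, z) \<in> ?G" for x z
    using that by (auto simp: Omega_def)
  have pos: "u x - v x > 0" if "x \<in> {-1..1}" for x
    using gap[OF that] \<open>0 < d\<close> by linarith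
  have "continuous_on (closure ?G) (\<lambda>q. u (fst q))" "continuous_on (closure ?G) (\<lambda>q. v (fst q))"
    by (rule continuous_on_compose2[OF cont(1)] continuous_on_compose2[OF cont(2)];
        use cl in \<open>auto intro!: continuous_intros\<close>)+
  then have contAB: "continuous_on (closure ?G) A" "continuous_on (closure ?G) B"
    unfolding A_def B_def using pos cl by (auto intro!: continuous_intros; force)+
  have "?G \<subseteq> S"
    by (auto simp: S_def)
  have diff: "\<phi> differentiable (at q within S)" "pdx S \<phi> differentiable (at q within S)"
     "pdz S \<phi> differentiable (at q within S)" if "q \<in> ?G" for q
    using reg(2) that \<open>?G \<subseteq> S\<close> unfolding C2a_2d_def by auto
  have dphi: "((\<lambda>t. \<phi> (t, z)) has_real_derivative pdx S \<phi> (x, z)) (at x)"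
      "((\<lambda>t. pdx S \<phi> (t, z)) has_real_derivative pdx S (pdx S \<phi>) (x, z)) (at x)"
      "((\<lambda>t. \<phi> (x, t)) has_real_derivative pdz S \<phi> (x, z)) (at z)"
      "((\<lambda>t. pdz S \<phi> (x, t)) has_real_derivative pdz S (pdz S \<phi>) (x, z)) (at z)"
    if "(x, z) \<in> ?G" for x z
    using diff[OF that] \<open>open ?G\<close> that \<open>?G \<subseteq> S\<close>
    by (auto intro!: has_real_derivative_pdx has_real_derivative_pdz)
  have dA: "((\<lambda>t. A (t, z)) has_real_derivative Ax (x, z)) (at x)"
      "((\<lambda>t. Ax (t, z)) has_real_derivative Axx (x, z)) (at x)"
      "((\<lambda>t. A (x, t)) has_real_derivative Az (x, z)) (at z)"
      "((\<lambda>t. Az (x, t)) has_real_derivative 0) (at z)"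
    if "(x, z) \<in> ?G" for x z
  proof -
    have x: "x \<in> {-1<..<1}"
      using GD[OF that] by simp
    then have D: "u x - v x \<noteq> 0"
      using pos[of x] by auto
    note [derivative_intros] = du(1)[OF x] dv(1)[OF x] du(2)[OF x] dv(2)[OF x]
    show "((\<lambda>t. A (t, z)) has_real_derivative Ax (x, z)) (at x)"
      unfolding A_def Ax_def fst_conv snd_conv using D
      by (auto intro!: derivative_eq_intros simp: power2_eq_square)
    show "((\<lambda>t. Ax (t, z)) has_real_derivative Axx (x, z)) (at x)"
    proof -
      have "((\<lambda>t. z - v t) has_real_derivative - v1 x) (at x)"
        "((\<lambda>t. u t - v t) has_real_derivative u1 x - v1 x) (at x)"
        "((\<lambda>t. - v1 t) has_real_derivative - v2 x) (at x)"
        "((\<lambda>t. u1 t - v1 t) has_real_derivative u2 x - v2 x) (at x)"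
        by (auto intro!: derivative_eq_intros)
      from quotient_second_derivative[OF this D] show ?thesis
        unfolding Axx_def Ax_def fst_conv snd_conv by simp
    qed
    show "((\<lambda>t. A (x, t)) has_real_derivative Az (x, z)) (at z)"
      unfolding A_def Az_def fst_conv snd_conv using D
      by (auto intro!: derivative_eq_intros simp: power2_eq_square)
    show "((\<lambda>t. Az (x, t)) has_real_derivative 0) (at z)"
      unfolding Az_def fst_conv by simp
  qed
  have dB: "((\<lambda>t. B (t, z)) has_real_derivative Bx (x, z)) (at x)"
      "((\<lambda>t. Bx (t, z)) has_real_derivative Bxx (x, z)) (at x)"
      "((\<lambda>t. B (x, t)) has_real_derivative Bz (x, z)) (at z)"
      "((\<lambda>t. Bz (x, t)) has_real_derivative -2) (at z)"
    if "(x, z) \<in> ?G" for x z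
  proof -
    have x: "x \<in> {-1<..<1}"
      using GD[OF that] by simp
    note [derivative_intros] = du(1)[OF x] dv(1)[OF x] du(2)[OF x] dv(2)[OF x]
    show "((\<lambda>t. B (t, z)) has_real_derivative Bx (x, z)) (at x)"
      "((\<lambda>t. Bx (t, z)) has_real_derivative Bxx (x, z)) (at x)"
      "((\<lambda>t. B (x, t)) has_real_derivative Bz (x, z)) (at z)"
      "((\<lambda>t. Bz (x, t)) has_real_derivative -2) (at z)"
      unfolding B_def Bx_def Bxx_def Bz_def fst_conv snd_conv
      by (auto intro!: derivative_eq_intros simp: algebra_simps)
  qed
  \<comment> \<open>The 10 for \<open>Bxx\<close> is 1 + 8 + 1, the middle part coming from the
    product of the two slopes.\<close>
  have Axx_bd: "\<bar>Axx q\<bar> \<le> 51 / d^3" and Bxx_bd: "\<bar>Bxx q\<bar> \<le> 10" if "q \<in> ?G" for q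
  proof -
    obtain x z where q: "q = (x, z)"
      by (cases q)
    then have xz: "x \<in> {-1<..<1}" "v x < z" "z < u x"
      using GD that by auto
    then have xI: "x \<in> {-1..1}"
      by auto
    note b = C2_profileD(3)[OF u xz(1)] C2_profileD(3)[OF v xz(1)]
      C2_profileD(4)[OF u xI] C2_profileD(4)[OF v xI] gap[OF xI]
    show "\<bar>Axx q\<bar> \<le> 51 / d^3"
      unfolding Axx_def q fst_conv snd_conv
      by (rule quotient_second_derivative_bound[OF \<open>0 < d\<close>]) (use b xz in linarith)+
    have "\<bar>v2 x * (u x - z)\<bar> \<le> 1 * 1" "\<bar>v1 x * u1 x\<bar> \<le> 2 * 2" "\<bar>(z - v x) * u2 x\<bar> \<le> 1 * 1"
      unfolding abs_mult by (rule mult_mono; use b xz in linarith)+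
    then show "\<bar>Bxx q\<bar> \<le> 10"
      unfolding Bxx_def q fst_conv snd_conv by linarith
  qed
  have main: "0 \<le> s * (\<phi> p - A p) + K * B p" if s: "s \<in> {-1, 1}" for s :: real
  proof (rule anisotropic_minimum_principle[OF \<open>open ?G\<close> \<open>bounded ?G\<close>, where a = \<epsilon>
      and \<psi> = "\<lambda>p. s * (\<phi> p - A p) + K * B p"
      and \<psi>x = "\<lambda>p. s * (pdx S \<phi> p - Ax p) + K * Bx p"
      and \<psi>xx = "\<lambda>p. s * (pdx S (pdx S \<phi>) p - Axx p) + K * Bxx p"
      and \<psi>z = "\<lambda>p. s * (pdz S \<phi> p - Az p) + K * Bz p"
      and \<psi>zz = "\<lambda>p. s * (pdz S (pdz S \<phi>) p - 0) + K * (- 2)"])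
    show "continuous_on (closure ?G) (\<lambda>p. s * (\<phi> p - A p) + K * B p)"
      by (intro continuous_intros reg contAB)
    \<comment> \<open>The frontier also has lateral sides, on which \<open>B\<close> need not
      vanish; there \<open>\<phi>\<close> still equals \<open>A\<close>, and
      \<open>0 \<le> B q\<close> is enough.\<close>
    show "0 \<le> s * (\<phi> q - A q) + K * B q" if "q \<in> frontier ?G" for q
    proof -
      have "q \<in> closure ?G"
        using that by (simp add: frontier_def)
      then have "0 \<le> B q"
        using cl by (simp add: B_def)
      moreover have "\<phi> q = A q"
        using bdry[OF that] by (simp add: A_def)
      ultimately show ?thesis
        using \<open>K > 0\<close> by simp
    qed
    show "\<epsilon>\<^sup>2 * (s * (pdx S (pdx S \<phi>) q - Axx q) + K * Bxx q)
        + (s * (pdz S (pdz S \<phi>) q - 0) + K * (- 2)) < 0" if "q \<in> ?G" for q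
    proof -
      have "\<epsilon>\<^sup>2 * (s * (pdx S (pdx S \<phi>) q - Axx q) + K * Bxx q) + (s * (pdz S (pdz S \<phi>) q - 0) + K * (- 2))
          = s * (\<epsilon>\<^sup>2 * pdx S (pdx S \<phi>) q + pdz S (pdz S \<phi>) q) - \<epsilon>\<^sup>2 * (s * Axx q) + K * (\<epsilon>\<^sup>2 * Bxx q - 2)"
        by (simp add: algebra_simps)
      also have "\<dots> = - \<epsilon>\<^sup>2 * (s * Axx q) + K * (\<epsilon>\<^sup>2 * Bxx q - 2)"
        using pde[OF that] by simp
      also have "\<dots> \<le> \<epsilon>\<^sup>2 * (51 / d^3) + K * (- 1)"
      proof (rule add_mono)
        have "- (s * Axx q) \<le> 51 / d^3"
          using s Axx_bd[OF that] by auto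
        from mult_left_mono[OF this, of "\<epsilon>\<^sup>2"] show "- \<epsilon>\<^sup>2 * (s * Axx q) \<le> \<epsilon>\<^sup>2 * (51 / d^3)"
          by simp
        have "\<epsilon>\<^sup>2 * \<bar>Bxx q\<bar> \<le> 1 / 10 * 10"
          using Bxx_bd[OF that] eps by (intro mult_mono) auto
        moreover have "\<epsilon>\<^sup>2 * Bxx q \<le> \<epsilon>\<^sup>2 * \<bar>Bxx q\<bar>"
          by (intro mult_left_mono) auto
        ultimately have "\<epsilon>\<^sup>2 * Bxx q \<le> 1"
          by linarith
        then show "K * (\<epsilon>\<^sup>2 * Bxx q - 2) \<le> K * (- 1)"
          using \<open>K > 0\<close> by (intro mult_left_mono) auto
      qed
      also have "\<dots> < 0"
        using eps \<open>0 < d\<close> by (simp add: K_def field_simps)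
      finally show ?thesis .
    qed
  qed (assumption | rule p DERIV_add DERIV_cmult DERIV_diff dphi dA dB)+
  have "\<bar>\<phi> p - A p\<bar> \<le> K * B p"
    using main[of 1] main[of "-1"] by auto
  then show ?thesis
    by (simp add: A_def B_def K_def)
qed

section \<open>Perturbed equations for the profiles\<close>

text \<open>With \<open>q\<close> the vertical derivative at a graph, \<open>- w' * q\<close> is the
  horizontal one. The difference of squares factors as \<open>(q - r) * (q + r)\<close> with
  \<open>r = 1 / D\<close>, which gives the first part of the constant; the horizontal square
  carries the factor \<open>\<epsilon>\<^sup>2\<close> already and gives the second.\<close>

lemma gradient_square_estimate:
  fixes q w' D d K \<epsilon> :: real
  assumes "0 < d" "d \<le> D" "D \<le> 1" "\<bar>q - 1 / D\<bar> \<le> K * \<epsilon>\<^sup>2" "\<bar>w'\<bar> \<le> 2" "\<epsilon>\<^sup>2 \<le> 1" "0 \<le> K"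
  shows "\<bar>((\<epsilon> * (- w' * q))\<^sup>2 + q\<^sup>2) - 1 / D\<^sup>2\<bar> \<le> (K * (2 / d + K) + 4 * (1 / d + K)\<^sup>2) * \<epsilon>\<^sup>2"
proof -
  define r where "r = 1 / D"
  have r: "0 < r" "r \<le> 1 / d"
    using assms by (auto simp: r_def field_simps)
  have "K * \<epsilon>\<^sup>2 \<le> K"
    using assms by (simp add: mult_left_le)
  then have q: "\<bar>q\<bar> \<le> 1 / d + K" "\<bar>q + r\<bar> \<le> 2 / d + K"
    using assms(4) r unfolding r_def[symmetric] by (auto simp: abs_le_iff)
  have "\<bar>(q - r) * (q + r)\<bar> \<le> (K * \<epsilon>\<^sup>2) * (2 / d + K)"
    unfolding abs_mult using q assms(4) r by (intro mult_mono) (auto simp: r_def)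
  then have 1: "\<bar>q\<^sup>2 - r\<^sup>2\<bar> \<le> K * (2 / d + K) * \<epsilon>\<^sup>2"
    by (simp add: power2_eq_square algebra_simps)
  have "w'\<^sup>2 \<le> 4" "q\<^sup>2 \<le> (1 / d + K)\<^sup>2"
    using power_mono[OF assms(5), of 2] power_mono[OF q(1), of 2] by auto
  then have "w'\<^sup>2 * q\<^sup>2 \<le> 4 * (1 / d + K)\<^sup>2"
    by (intro mult_mono) auto
  then have 2: "(\<epsilon> * (- w' * q))\<^sup>2 \<le> 4 * (1 / d + K)\<^sup>2 * \<epsilon>\<^sup>2"
    by (simp add: power_mult_distrib mult.commute mult_left_mono)
  have "0 \<le> (\<epsilon> * (- w' * q))\<^sup>2"
    by simp
  with 1 2 show ?thesis
    unfolding distrib_right[of _ _ "\<epsilon>\<^sup>2"] r_def power_divide power_one by linarith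
qed

text \<open>The constant of \<open>gradient_square_estimate\<close> for the barrier constant
  \<open>K = 52 / d^3\<close>.\<close>

definition gradient_error :: "real \<Rightarrow> real" where
  "gradient_error d = 52 / d^3 * (2 / d + 52 / d^3) + 4 * (1 / d + 52 / d^3)\<^sup>2"

text \<open>The barrier is read in two ways: inside, where the product of distances is at most 1, it
  bounds the potential; at the graphs, after division by the distance, it gives the gradients in the
  right-hand sides. The numerator \<open>- mu\<close> puts both equations into the common form
  \<open>c / (u x - v x)\<^sup>2\<close>.\<close>

lemma solution_estimates:
  fixes u v :: "real \<Rightarrow> real" and \<phi> :: "real \<times> real \<Rightarrow> real"
  assumes eps: "0 < \<epsilon>" "\<epsilon>\<^sup>2 \<le> 1 / 10" and "0 < d" and "0 < lam" "0 < mu"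
    and sol: "is_solution_P \<epsilon> lam mu u v \<phi>"
    and reg: "C2a_interval \<alpha> u" "C2a_interval \<alpha> v"
      "continuous_on (closure (Omega u v)) \<phi>" "C2a_2d \<alpha> (Omega u v \<union> Gamma u \<union> Gamma v) \<phi>"
    and second: "\<And>x. x \<in> {-1<..<1} \<Longrightarrow> \<bar>deriv (deriv u) x\<bar> \<le> 1 \<and> \<bar>deriv (deriv v) x\<bar> \<le> 1"
    and gap: "\<And>x. x \<in> {-1..1} \<Longrightarrow> d \<le> u x - v x \<and> u x \<le> 0 \<and> -1 \<le> v x"
  shows "\<exists>u1 u2 v1 v2. C2_profile u u1 u2 \<and> C2_profile v v1 v2 \<and>
     (\<forall>x\<in>{-1<..<1}. \<bar>u2 x - lam / (u x - v x)\<^sup>2\<bar> \<le> lam * gradient_error d * \<epsilon>\<^sup>2 \<and>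
                    \<bar>v2 x - (- mu) / (u x - v x)\<^sup>2\<bar> \<le> mu * gradient_error d * \<epsilon>\<^sup>2)"
    and "p \<in> Omega u v \<Longrightarrow> \<bar>\<phi> p - (snd p - v (fst p)) / (u (fst p) - v (fst p))\<bar> \<le> 52 / d^3 * \<epsilon>\<^sup>2"
proof -
  define S where "S = Omega u v \<union> Gamma u \<union> Gamma v"
  define K where "K = 52 / d^3"
  have "K > 0"
    using \<open>0 < d\<close> by (simp add: K_def)
  note sol' = sol[unfolded is_solution_P_def Let_def, folded S_def]
  have vals: "u (-1) = u 1" "v (-1) = v 1"
    using sol' by auto
  obtain u1 u2 where u: "C2_profile u u1 u2" and u2: "\<And>x. x \<in> {-1<..<1} \<Longrightarrow> deriv (deriv u) x = u2 x"
    using C2a_interval_profile[OF reg(1) vals(1)] second by blast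
  obtain v1 v2 where v: "C2_profile v v1 v2" and v2: "\<And>x. x \<in> {-1<..<1} \<Longrightarrow> deriv (deriv v) x = v2 x"
    using C2a_interval_profile[OF reg(2) vals(2)] second by blast
  have barrier: "\<bar>\<phi> p - (snd p - v (fst p)) / (u (fst p) - v (fst p))\<bar>
      \<le> K * \<epsilon>\<^sup>2 * ((snd p - v (fst p)) * (u (fst p) - snd p))" if "p \<in> closure (Omega u v)" for p
    unfolding K_def
    by (rule potential_barrier[OF eps \<open>0 < d\<close> u v gap reg(3,4) _ _ that])
       (use sol' in \<open>auto simp: S_def\<close>)
  have inside: "-1 < x" "x < 1" "v x < z" "z < u x" "d \<le> u x - v x" "u x \<le> 0" "-1 \<le> v x"
    if "(x, z) \<in> Omega u v" for x z
    using that gap[of x] by (auto simp: Omega_def)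
  show "\<bar>\<phi> p - (snd p - v (fst p)) / (u (fst p) - v (fst p))\<bar> \<le> 52 / d^3 * \<epsilon>\<^sup>2" if "p \<in> Omega u v"
  proof -
    obtain x z where p: "p = (x, z)"
      by (cases p)
    note i = inside[OF that[unfolded p]]
    have "(z - v x) * (u x - z) \<le> 1 * 1"
      using i by (intro mult_mono) auto
    then have "K * \<epsilon>\<^sup>2 * ((z - v x) * (u x - z)) \<le> K * \<epsilon>\<^sup>2 * 1"
      using \<open>K > 0\<close> by (intro mult_left_mono) auto
    then show ?thesis
      using barrier[of p] that closure_subset[of "Omega u v"] by (auto simp: p K_def)
  qed
  have lt: "v x < u x" if "x \<in> {-1<..<1}" for x
    using gap[of x] that \<open>0 < d\<close> by auto
  \<comment> \<open>On the graphs the boundary data reduce to the constants 1 and 0, which is what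
    \<open>boundary_partials\<close> asks of its curve.\<close>
  have phi_u: "(x, u x) \<in> S" "\<phi> (x, u x) = 1" and phi_v: "(x, v x) \<in> S" "\<phi> (x, v x) = 0"
    if x: "x \<in> {-1<..<1}" for x
  proof -
    have "(x, u x) \<in> Gamma u" "(x, v x) \<in> Gamma v"
      using x by (auto simp: Gamma_def)
    moreover from this have "(x, u x) \<in> frontier (Omega u v)" "(x, v x) \<in> frontier (Omega u v)"
      using Gamma_subset_frontier_Omega[of v u] lt by blast+
    ultimately show "(x, u x) \<in> S" "\<phi> (x, u x) = 1" "(x, v x) \<in> S" "\<phi> (x, v x) = 0"
      using sol' lt[OF x] by (auto simp: S_def)
  qed
  have diff: "\<phi> differentiable (at q within S)" if "q \<in> S" for q
    using reg(4) that by (auto simp: C2a_2d_def S_def)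
  have vertical: "(x, z) \<in> S \<and>
      \<bar>\<phi> (x, z) - (z - v x) / (u x - v x)\<bar> \<le> K * \<epsilon>\<^sup>2 * ((z - v x) * (u x - z))"
    if "x \<in> {-1<..<1}" "v x < z" "z < u x" for x z
    using barrier[of "(x, z)"] closure_subset[of "Omega u v"] that by (auto simp: S_def Omega_def)
  have est: "\<bar>pdz S \<phi> (x, u x) - 1 / (u x - v x)\<bar> \<le> K * \<epsilon>\<^sup>2 \<and> pdx S \<phi> (x, u x) = - u1 x * pdz S \<phi> (x, u x) \<and>
      \<bar>pdz S \<phi> (x, v x) - 1 / (u x - v x)\<bar> \<le> K * \<epsilon>\<^sup>2 \<and> pdx S \<phi> (x, v x) = - v1 x * pdz S \<phi> (x, v x)"
    if x: "x \<in> {-1<..<1}" for x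
  proof -
    define D where "D = u x - v x"
    have D: "0 < D" "D \<le> 1"
      using lt[OF x] gap[of x] x by (auto simp: D_def)
    \<comment> \<open>At distance \<open>t\<close> from a graph the product of distances is
      \<open>t * (D - t)\<close>, at most \<open>t\<close> because \<open>D \<le> 1\<close>; the
      error becomes linear in \<open>t\<close>.\<close>
    have le: "K * \<epsilon>\<^sup>2 * (t * (D - t)) \<le> K * \<epsilon>\<^sup>2 * t" if "0 < t" "t < D" for t
      using that D \<open>K > 0\<close> by (intro mult_left_mono mult_left_le) auto
    have top: "(x, u x + (-1) * t) \<in> S \<and>
        \<bar>\<phi> (x, u x + (-1) * t) - 1 - (-1) * t * (1 / D)\<bar> \<le> (K * \<epsilon>\<^sup>2) * t" if "0 < t" "t < D" for t
    proof -
      have 1: "(u x + (-1) * t - v x) / (u x - v x) = 1 + (-1) * t * (1 / D)"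
        using D by (simp add: D_def field_simps)
      have 2: "(u x + (-1) * t - v x) * (u x - (u x + (-1) * t)) = t * (D - t)"
        by (simp add: D_def algebra_simps)
      have "v x < u x + (-1) * t" "u x + (-1) * t < u x"
        using that by (auto simp: D_def)
      from vertical[OF x this, unfolded 1 2] show ?thesis
        using le[OF that] unfolding diff_diff_eq by (blast intro: order_trans)
    qed
    have bottom: "(x, v x + 1 * t) \<in> S \<and>
        \<bar>\<phi> (x, v x + 1 * t) - 0 - 1 * t * (1 / D)\<bar> \<le> (K * \<epsilon>\<^sup>2) * t" if "0 < t" "t < D" for t
    proof -
      have 1: "(v x + 1 * t - v x) / (u x - v x) = 0 + 1 * t * (1 / D)"
        by (simp add: D_def)
      have 2: "(v x + 1 * t - v x) * (u x - (v x + 1 * t)) = t * (D - t)"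
        by (simp add: D_def algebra_simps)
      have "v x < v x + 1 * t" "v x + 1 * t < u x"
        using that by (auto simp: D_def)
      from vertical[OF x this, unfolded 1 2] show ?thesis
        using le[OF that] unfolding diff_diff_eq by (blast intro: order_trans)
    qed
    have "pdx S \<phi> (x, u x) = - u1 x * pdz S \<phi> (x, u x)" "\<bar>pdz S \<phi> (x, u x) - 1 / D\<bar> \<le> K * \<epsilon>\<^sup>2"
      by (rule boundary_partials[OF diff x _ C2_profileD(1)[OF u x] _ \<open>0 < D\<close> top]; use phi_u x in auto)+
    moreover
    have "pdx S \<phi> (x, v x) = - v1 x * pdz S \<phi> (x, v x)" "\<bar>pdz S \<phi> (x, v x) - 1 / D\<bar> \<le> K * \<epsilon>\<^sup>2"
      by (rule boundary_partials[OF diff x _ C2_profileD(1)[OF v x] _ \<open>0 < D\<close> bottom]; use phi_v x in auto)+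
    ultimately show ?thesis
      by (simp add: D_def)
  qed
  have "\<bar>u2 x - lam / (u x - v x)\<^sup>2\<bar> \<le> lam * gradient_error d * \<epsilon>\<^sup>2"
    "\<bar>v2 x - (- mu) / (u x - v x)\<^sup>2\<bar> \<le> mu * gradient_error d * \<epsilon>\<^sup>2" if x: "x \<in> {-1<..<1}" for x
  proof -
    have xI: "x \<in> {-1..1}"
      using x by auto
    have D: "d \<le> u x - v x" "u x - v x \<le> 1"
      using gap[OF xI] by auto
    have "\<epsilon>\<^sup>2 \<le> 1"
      using eps by simp
    note * = gradient_square_estimate[OF \<open>0 < d\<close> D _ _ this less_imp_le[OF \<open>K > 0\<close>]]
    have "\<bar>((\<epsilon> * pdx S \<phi> (x, u x))\<^sup>2 + (pdz S \<phi> (x, u x))\<^sup>2) - 1 / (u x - v x)\<^sup>2\<bar> \<le> gradient_error d * \<epsilon>\<^sup>2"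
      "\<bar>((\<epsilon> * pdx S \<phi> (x, v x))\<^sup>2 + (pdz S \<phi> (x, v x))\<^sup>2) - 1 / (u x - v x)\<^sup>2\<bar> \<le> gradient_error d * \<epsilon>\<^sup>2"
      using est[OF x] *[of _ "u1 x"] *[of _ "v1 x"] C2_profileD(4)[OF u xI] C2_profileD(4)[OF v xI]
      unfolding gradient_error_def K_def[symmetric] by metis+
    note mult_left_mono[OF this(1) less_imp_le[OF \<open>0 < lam\<close>]] mult_left_mono[OF this(2) less_imp_le[OF \<open>0 < mu\<close>]]
    moreover have scale: "c * \<bar>a - b\<bar> = \<bar>c * a - c * b\<bar>" if "0 < c" for a b c :: real
      using that by (simp add: abs_mult flip: right_diff_distrib)
    moreover have "u2 x = lam * ((\<epsilon> * pdx S \<phi> (x, u x))\<^sup>2 + (pdz S \<phi> (x, u x))\<^sup>2)"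
      "v2 x = - mu * ((\<epsilon> * pdx S \<phi> (x, v x))\<^sup>2 + (pdz S \<phi> (x, v x))\<^sup>2)"
      using sol' u2[OF x] v2[OF x] x by auto
    ultimately show "\<bar>u2 x - lam / (u x - v x)\<^sup>2\<bar> \<le> lam * gradient_error d * \<epsilon>\<^sup>2"
      "\<bar>v2 x - (- mu) / (u x - v x)\<^sup>2\<bar> \<le> mu * gradient_error d * \<epsilon>\<^sup>2"
      unfolding scale[OF \<open>0 < lam\<close>] scale[OF \<open>0 < mu\<close>] by (auto simp: mult.assoc abs_minus_commute)
  qed
  then show "\<exists>u1 u2 v1 v2. C2_profile u u1 u2 \<and> C2_profile v v1 v2 \<and>
     (\<forall>x\<in>{-1<..<1}. \<bar>u2 x - lam / (u x - v x)\<^sup>2\<bar> \<le> lam * gradient_error d * \<epsilon>\<^sup>2 \<and>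
                    \<bar>v2 x - (- mu) / (u x - v x)\<^sup>2\<bar> \<le> mu * gradient_error d * \<epsilon>\<^sup>2)"
    using u v by blast
qed

section \<open>Limits of profiles\<close>

text \<open>\<open>has_derivative_sequence\<close> yields a limit \<open>h\<close> of its own;
  uniqueness of pointwise limits identifies it with \<open>g\<close> on the open interval, so the
  derivative carries over.\<close>

lemma has_real_derivative_uniform_limit:
  fixes f f' :: "nat \<Rightarrow> real \<Rightarrow> real"
  assumes f: "\<And>n x. x \<in> {a<..<b} \<Longrightarrow> (f n has_real_derivative f' n x) (at x)"
    and f': "uniform_limit {a<..<b} f' g' sequentially"
    and lim: "\<And>x. x \<in> {a<..<b} \<Longrightarrow> (\<lambda>n. f n x) \<longlonglongrightarrow> g x"
    and x: "x \<in> {a<..<b}"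
  shows "(g has_real_derivative g' x) (at x)"
proof -
  have "\<exists>h. \<forall>x\<in>{a<..<b}. (\<lambda>n. f n x) \<longlonglongrightarrow> h x \<and> (h has_derivative (*) (g' x)) (at x within {a<..<b})"
  proof (rule has_derivative_sequence[where f' = "\<lambda>n x. (*) (f' n x)"])
    show "(f n has_derivative (*) (f' n x)) (at x within {a<..<b})" if "x \<in> {a<..<b}" for n x
      using f[OF that] by (auto simp: has_field_derivative_def intro: has_derivative_at_withinI)
    show "\<forall>\<^sub>F n in sequentially. \<forall>x\<in>{a<..<b}. \<forall>h. norm (f' n x * h - g' x * h) \<le> e * norm h" if "e > 0" for e
      using uniform_limitD[OF f' that]
      by eventually_elim (auto simp: dist_real_def abs_mult mult_right_mono simp flip: left_diff_distrib)
  qed (use lim x in auto)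
  then obtain h where h: "\<And>x. x \<in> {a<..<b} \<Longrightarrow> (\<lambda>n. f n x) \<longlonglongrightarrow> h x"
    "(h has_derivative (*) (g' x)) (at x within {a<..<b})"
    using x by blast
  have "h y = g y" if "y \<in> {a<..<b}" for y
    using LIMSEQ_unique[OF h(1)[OF that] lim[OF that]] .
  moreover have "(h has_real_derivative g' x) (at x)"
    using h(2) by (simp only: has_field_derivative_def at_within_open[OF x open_greaterThanLessThan])
  ultimately show ?thesis
    using has_field_derivative_transform_within_open[OF _ open_greaterThanLessThan x] by blast
qed

text \<open>In the factored difference \<open>a + b\<close> is at most 2 and the denominator at
  least \<open>d^4\<close>. This makes the singular right-hand side Lipschitz once the gap is
  bounded below.\<close>

lemma inverse_square_diff_le:
  fixes a b d :: real
  assumes "0 < d" "d \<le> a" "d \<le> b" "a \<le> 1" "b \<le> 1"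
  shows "\<bar>1 / a\<^sup>2 - 1 / b\<^sup>2\<bar> \<le> 2 / d^4 * \<bar>a - b\<bar>"
proof -
  have "1 / a\<^sup>2 - 1 / b\<^sup>2 = (b - a) * (a + b) / (a\<^sup>2 * b\<^sup>2)"
    using assms by (simp add: field_simps power2_eq_square)
  then have "\<bar>1 / a\<^sup>2 - 1 / b\<^sup>2\<bar> = \<bar>a - b\<bar> * (a + b) / (a\<^sup>2 * b\<^sup>2)"
    using assms by (simp add: abs_mult abs_minus_commute)
  also have "\<dots> \<le> \<bar>a - b\<bar> * 2 / (d\<^sup>2 * d\<^sup>2)"
    using assms by (intro frac_le mult_mono mult_left_mono power_mono) auto
  also have "\<dots> = 2 / d^4 * \<bar>a - b\<bar>"
    by (simp flip: power_add)
  finally show ?thesis .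
qed

text \<open>The limit of derivatives is taken twice, from \<open>w\<close> to \<open>w1\<close> and
  from \<open>w1\<close> to \<open>w2\<close>. The common Lipschitz bound on \<open>w1\<close>
  survives pointwise limits and places \<open>w0\<close> in \<open>W2inf\<close>.\<close>

lemma C2_profile_limit:
  assumes prof: "\<And>n. C2_profile (w n) (w1 n) (w2 n)"
    and lim: "uniform_limit {-1..1} w w0 sequentially" "uniform_limit {-1..1} w1 p0 sequentially"
      "uniform_limit {-1<..<1} w2 q0 sequentially"
  shows "W2inf w0"
    and "x \<in> {-1<..<1} \<Longrightarrow> (w0 has_real_derivative p0 x) (at x)"
    and "x \<in> {-1<..<1} \<Longrightarrow> deriv w0 x = p0 x"
    and "x \<in> {-1<..<1} \<Longrightarrow> (deriv w0 has_real_derivative q0 x) (at x)"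
proof -
  have sub: "{-1<..<1} \<subseteq> {-1..1::real}"
    by auto
  have ptw: "(\<lambda>n. w n x) \<longlonglongrightarrow> w0 x" "(\<lambda>n. w1 n x) \<longlonglongrightarrow> p0 x" if "x \<in> {-1..1}" for x
    using lim that by (auto intro: tendsto_uniform_limitI)
  have d1: "(w0 has_real_derivative p0 x) (at x)" if "x \<in> {-1<..<1}" for x
    by (rule has_real_derivative_uniform_limit[OF C2_profileD(1)[OF prof] uniform_limit_on_subset[OF lim(2) sub] _ that])
       (use ptw in auto)
  have d2: "(p0 has_real_derivative q0 x) (at x)" if "x \<in> {-1<..<1}" for x
    by (rule has_real_derivative_uniform_limit[OF C2_profileD(2)[OF prof] lim(3) _ that]) (use ptw in auto)
  have eq: "deriv w0 x = p0 x" if "x \<in> {-1<..<1}" for x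
    using d1[OF that] by (rule DERIV_imp_deriv)
  have d2': "(deriv w0 has_real_derivative q0 x) (at x)" if "x \<in> {-1<..<1}" for x
    by (rule has_field_derivative_transform_within_open[OF d2[OF that] open_greaterThanLessThan that]) (simp add: eq)
  have "continuous_on {-1..1} w0"
    by (rule uniform_limit_theorem[OF _ lim(1)]) (auto intro!: always_eventually continuous_on_C2_profile[OF prof])
  moreover have "1-lipschitz_on {-1<..<1} (deriv w0)"
  proof (rule lipschitz_onI)
    fix x y :: real assume xy: "x \<in> {-1<..<1}" "y \<in> {-1<..<1}"
    have "(\<lambda>n. \<bar>w1 n x - w1 n y\<bar>) \<longlonglongrightarrow> \<bar>p0 x - p0 y\<bar>"
      by (intro tendsto_intros ptw) (use xy in auto)
    moreover have "\<bar>w1 n x - w1 n y\<bar> \<le> \<bar>x - y\<bar>" for n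
      using C2_profileD(6)[OF prof] xy by auto
    ultimately have "\<bar>p0 x - p0 y\<bar> \<le> \<bar>x - y\<bar>"
      by (intro LIMSEQ_le_const2) auto
    then show "dist (deriv w0 x) (deriv w0 y) \<le> 1 * dist x y"
      using eq[OF xy(1)] eq[OF xy(2)] by (simp add: dist_real_def)
  qed simp
  moreover have "w0 differentiable (at x)" if "x \<in> {-1<..<1}" for x
    using d1[OF that] real_differentiable_def by blast
  ultimately show "W2inf w0"
    unfolding W2inf_def by blast
  show "x \<in> {-1<..<1} \<Longrightarrow> (w0 has_real_derivative p0 x) (at x)" "x \<in> {-1<..<1} \<Longrightarrow> deriv w0 x = p0 x"
    "x \<in> {-1<..<1} \<Longrightarrow> (deriv w0 has_real_derivative q0 x) (at x)"
    using d1 eq d2' by auto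
qed

section \<open>Convergence of the potentials\<close>

text \<open>The graph is the image of a null segment under a map differentiable there. It matters
  because on the limit graphs the truncated potentials may fail to converge pointwise.\<close>

lemma negligible_Gamma:
  assumes "\<And>x. x \<in> {-1<..<1} \<Longrightarrow> (w has_real_derivative w' x) (at x)"
  shows "negligible (Gamma w)"
proof -
  define f :: "real \<times> real \<Rightarrow> real \<times> real" where "f = (\<lambda>p. (fst p, w (fst p)))"
  let ?L = "{-1<..<1::real} \<times> {0::real}"
  have "negligible {p :: real \<times> real. p \<bullet> (0, 1) = 0}"
    by (rule negligible_standard_hyperplane) (simp add: Basis_prod_def)
  then have "negligible ?L"
    by (rule negligible_subset) auto
  moreover have "f differentiable_on ?L"
    unfolding differentiable_on_def
  proof
    fix p assume "p \<in> ?L"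
    then have w': "(w has_derivative (*) (w' (fst p))) (at (fst p))"
      using assms[of "fst p"] by (auto simp: has_field_derivative_def)
    have "((\<lambda>p. (fst p, w (fst p))) has_derivative (\<lambda>h. (fst h, w' (fst p) * fst h))) (at p within ?L)"
      by (intro has_derivative_Pair has_derivative_compose[where f = fst, OF _ w'] has_derivative_fst has_derivative_ident)
    then show "f differentiable at p within ?L"
      unfolding f_def differentiable_def by blast
  qed
  ultimately have "negligible (f ` ?L)"
    by (intro negligible_differentiable_image_negligible) auto
  moreover have "Gamma w = f ` ?L"
    by (force simp: Gamma_def f_def)
  ultimately show ?thesis
    by simp
qed

lemma affine_interpolant_indicator_measurable:
  assumes u: "continuous_on {-1<..<1} u" and v: "continuous_on {-1<..<1} v"
  shows "(\<lambda>p. (snd p - v (fst p)) / (u (fst p) - v (fst p)) * indicator (Omega u v) p) \<in> borel_measurable borel"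
proof -
  have "continuous_on (Omega u v) (\<lambda>p. u (fst p))" "continuous_on (Omega u v) (\<lambda>p. v (fst p))"
    by (rule continuous_on_compose2[OF u] continuous_on_compose2[OF v];
        auto intro!: continuous_intros simp: Omega_def)+
  then have "continuous_on (Omega u v) (\<lambda>p. (snd p - v (fst p)) / (u (fst p) - v (fst p)))"
    by (intro continuous_intros) (auto simp: Omega_def)
  from borel_measurable_continuous_on_indicator[OF borel_open[OF open_Omega[OF u v]] this]
  show ?thesis
    by (simp add: mult.commute)
qed

text \<open>Dominated convergence with the constant majorant \<open>(M + 2)\<^sup>2\<close>: inside
  its domain \<open>\<phi> n\<close> differs by at most \<open>M\<close> from an interpolant with
  values between 0 and 1. A point off the limit graphs is eventually inside, or eventually outside,
  the approximating domains; in the first case \<open>close\<close> reduces the claim to the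
  interpolants.\<close>

lemma potential_L2_limit:
  fixes u v :: "nat \<Rightarrow> real \<Rightarrow> real" and \<phi> :: "nat \<Rightarrow> real \<times> real \<Rightarrow> real"
  assumes lim: "\<And>x. x \<in> {-1<..<1} \<Longrightarrow> (\<lambda>n. u n x) \<longlonglongrightarrow> u0 x" "\<And>x. x \<in> {-1<..<1} \<Longrightarrow> (\<lambda>n. v n x) \<longlonglongrightarrow> v0 x"
    and cont: "\<And>n. continuous_on {-1<..<1} (u n)" "\<And>n. continuous_on {-1<..<1} (v n)"
      "\<And>n. continuous_on (Omega (u n) (v n)) (\<phi> n)"
    and der: "\<And>x. x \<in> {-1<..<1} \<Longrightarrow> (u0 has_real_derivative u0' x) (at x)"
      "\<And>x. x \<in> {-1<..<1} \<Longrightarrow> (v0 has_real_derivative v0' x) (at x)"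
    and lt: "\<And>x. x \<in> {-1<..<1} \<Longrightarrow> v0 x < u0 x"
    and close: "\<And>n p. p \<in> Omega (u n) (v n) \<Longrightarrow>
      \<bar>\<phi> n p - (snd p - v n (fst p)) / (u n (fst p) - v n (fst p))\<bar> \<le> \<delta> n"
    and \<delta>: "\<delta> \<longlonglongrightarrow> 0" "\<And>n. 0 \<le> \<delta> n" "\<And>n. \<delta> n \<le> M"
  defines "\<phi>0 \<equiv> \<lambda>(x, z). (z - v0 x) / (u0 x - v0 x)"
    and "R \<equiv> {-1<..<1} \<times> {-1<..<0}"
  defines "D \<equiv> \<lambda>n p. \<phi> n p * indicator (Omega (u n) (v n)) p - \<phi>0 p * indicator (Omega u0 v0) p"
  shows "(\<lambda>p. (D n p)\<^sup>2) integrable_on R" "(\<lambda>n. integral R (\<lambda>p. (D n p)\<^sup>2)) \<longlonglongrightarrow> 0"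
proof -
  have phi0: "\<phi>0 = (\<lambda>p. (snd p - v0 (fst p)) / (u0 (fst p) - v0 (fst p)))"
    by (auto simp: \<phi>0_def)
  have frac: "\<bar>(z - b) / (a - b)\<bar> \<le> 1" if "b < z" "z < a" for a b z :: real
    using that by (simp add: field_simps)
  have bound: "norm ((D n p)\<^sup>2) \<le> (M + 2)\<^sup>2" for n p
  proof -
    have "0 \<le> M"
      using \<delta>(2,3)[of 0] by linarith
    have "\<bar>\<phi> n p * indicator (Omega (u n) (v n)) p\<bar> \<le> M + 1"
    proof (cases "p \<in> Omega (u n) (v n)")
      case True
      then have "\<bar>(snd p - v n (fst p)) / (u n (fst p) - v n (fst p))\<bar> \<le> 1"
        by (intro frac) (auto simp: Omega_def)
      with close[OF True] \<delta>(3)[of n] have "\<bar>\<phi> n p\<bar> \<le> M + 1"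
        by linarith
      with True show ?thesis
        by simp
    qed (use \<open>0 \<le> M\<close> in simp)
    moreover have "\<bar>\<phi>0 p * indicator (Omega u0 v0) p\<bar> \<le> 1"
    proof (cases "p \<in> Omega u0 v0")
      case True
      then show ?thesis
        unfolding phi0 using frac[of "v0 (fst p)" "snd p" "u0 (fst p)"] by (auto simp: Omega_def)
    qed simp
    ultimately have "\<bar>D n p\<bar> \<le> M + 2"
      unfolding D_def by linarith
    then show ?thesis
      using power_mono[of "\<bar>D n p\<bar>" "M + 2" 2] by simp
  qed
  have c0: "continuous_on {-1<..<1} u0" "continuous_on {-1<..<1} v0"
    using DERIV_isCont[OF der(1)] DERIV_isCont[OF der(2)] by (auto intro!: continuous_at_imp_continuous_on)
  have meas: "D n \<in> borel_measurable borel" for n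
  proof -
    have "(\<lambda>p. \<phi> n p * indicator (Omega (u n) (v n)) p) \<in> borel_measurable borel"
      using borel_measurable_continuous_on_indicator[OF borel_open[OF open_Omega[OF cont(1,2)]] cont(3), of n]
      by (simp add: mult.commute)
    then show ?thesis
      unfolding D_def phi0
      by (intro borel_measurable_diff affine_interpolant_indicator_measurable[OF c0])
  qed
  have "R \<in> lmeasurable"
    unfolding R_def by (intro lmeasurable_open bounded_Times open_Times) auto
  then have const: "(\<lambda>p :: real \<times> real. (M + 2)\<^sup>2) integrable_on R"
    by (rule integrable_on_const)
  have int: "(\<lambda>p. (D n p)\<^sup>2) integrable_on R" for n
  proof (rule measurable_bounded_by_integrable_imp_integrable[OF _ const bound])
    have "(\<lambda>p. (D n p)\<^sup>2) \<in> borel_measurable borel"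
      using meas by measurable
    then have "(\<lambda>p. (D n p)\<^sup>2) \<in> borel_measurable lebesgue"
      by (intro measurable_completion) simp
    then show "(\<lambda>p. (D n p)\<^sup>2) \<in> borel_measurable (lebesgue_on R)"
      by (rule measurable_restrict_space1)
    show "R \<in> sets lebesgue"
      using \<open>R \<in> lmeasurable\<close> by (rule fmeasurableD)
  qed
  then show "(\<lambda>p. (D n p)\<^sup>2) integrable_on R" .
  \<comment> \<open>\<open>dominated_convergence\<close> wants convergence at every point, so the
    limit graphs are cut out of \<open>R\<close> and restored afterwards as a null set.\<close>
  let ?N = "Gamma u0 \<union> Gamma v0"
  have negl: "negligible ?N"
    by (intro negligible_Un negligible_Gamma[OF der(1)] negligible_Gamma[OF der(2)])
  have negl': "negligible {p \<in> R - (R - ?N). f p \<noteq> 0}" "negligible {p \<in> (R - ?N) - R. f p \<noteq> 0}"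
    for f :: "real \<times> real \<Rightarrow> real"
    by (rule negligible_subset[OF negl]; blast)+
  have ptw: "(\<lambda>n. (D n p)\<^sup>2) \<longlonglongrightarrow> 0" if "p \<in> R - ?N" for p
  proof -
    obtain x z where p: "p = (x, z)"
      by (cases p)
    have x: "x \<in> {-1<..<1}" "z \<noteq> u0 x" "z \<noteq> v0 x"
      using that by (auto simp: p R_def Gamma_def)
    have "(\<lambda>n. D n p) \<longlonglongrightarrow> 0"
    proof (cases "v0 x < z \<and> z < u0 x")
      case True
      have ev: "\<forall>\<^sub>F n in sequentially. p \<in> Omega (u n) (v n)"
        using order_tendstoD(1)[OF lim(1)[OF x(1)], of z] order_tendstoD(2)[OF lim(2)[OF x(1)], of z] True
        by (auto simp: p Omega_def x(1)[simplified] elim: eventually_elim2)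
      define A where "A = (\<lambda>n. (z - v n x) / (u n x - v n x))"
      have "A \<longlonglongrightarrow> \<phi>0 p"
        unfolding A_def p \<phi>0_def prod.case using lt[OF x(1)]
        by (intro tendsto_intros lim x) simp
      moreover have "(\<lambda>n. (\<phi> n p - A n) * indicator (Omega (u n) (v n)) p) \<longlonglongrightarrow> 0"
      proof (rule Lim_null_comparison[OF _ \<delta>(1)])
        show "\<forall>\<^sub>F n in sequentially. norm ((\<phi> n p - A n) * indicator (Omega (u n) (v n)) p) \<le> \<delta> n"
          using ev by eventually_elim (use close in \<open>auto simp: p A_def\<close>)
      qed
      ultimately have "(\<lambda>n. (\<phi> n p - A n) * indicator (Omega (u n) (v n)) p + (A n - \<phi>0 p)) \<longlonglongrightarrow> 0 + (\<phi>0 p - \<phi>0 p)"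
        by (intro tendsto_intros)
      moreover have "\<forall>\<^sub>F n in sequentially.
          (\<phi> n p - A n) * indicator (Omega (u n) (v n)) p + (A n - \<phi>0 p) = D n p"
        using ev by eventually_elim (use True x in \<open>auto simp: D_def p Omega_def\<close>)
      ultimately show ?thesis
        using Lim_transform_eventually by fastforce
    next
      case False
      \<comment> \<open>Off the limit graphs the point lies strictly below \<open>v0 x\<close> or
        strictly above \<open>u0 x\<close>, and strict inequalities persist for large
        \<open>n\<close>.\<close>
      then have "\<forall>\<^sub>F n in sequentially. z < v n x \<or> u n x < z"
        using order_tendstoD(2)[OF lim(1)[OF x(1)], of z] order_tendstoD(1)[OF lim(2)[OF x(1)], of z] x
        by (cases "z < v0 x") (auto elim: eventually_mono)
      then have "\<forall>\<^sub>F n in sequentially. D n p = 0"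
        by eventually_elim (use False in \<open>auto simp: D_def p Omega_def\<close>)
      then show ?thesis
        by (rule tendsto_eventually)
    qed
    then show ?thesis
      using tendsto_power[of "\<lambda>n. D n p" 0 sequentially 2] by simp
  qed
  have "(\<lambda>n. integral (R - ?N) (\<lambda>p. (D n p)\<^sup>2)) \<longlonglongrightarrow> integral (R - ?N) (\<lambda>p. 0)"
    by (rule dominated_convergence(2)[where h = "\<lambda>p. (M + 2)\<^sup>2"])
       (use integrable_spike_set[OF int negl'] integrable_spike_set[OF const negl'] bound ptw in auto)
  moreover have "integral (R - ?N) (\<lambda>p. (D n p)\<^sup>2) = integral R (\<lambda>p. (D n p)\<^sup>2)" for n
    by (rule integral_spike_set[OF negl'(2,1)])
  ultimately show "(\<lambda>n. integral R (\<lambda>p. (D n p)\<^sup>2)) \<longlonglongrightarrow> 0"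
    by simp
qed

section \<open>Extraction of a null sequence and identification of the limit\<close>

theorem theorem2:
  fixes r0 \<alpha> a0 lam mu \<kappa>0 :: real
    and u v :: "real \<Rightarrow> real \<Rightarrow> real"
    and \<phi> :: "real \<Rightarrow> real \<times> real \<Rightarrow> real"
  assumes r0: "0 < r0" "r0 < 2/3"
    and alpha: "0 \<le> \<alpha>" "\<alpha> < 1"
    and a0: "0 < a0"
    and lam: "0 < lam" "lam \<le> a0"
    and mu: "0 < mu" "mu \<le> a0"
    and kappa0: "0 < \<kappa>0" "\<kappa>0 < 1/3"
    and sol: "\<And>\<epsilon>. \<epsilon> \<in> {0<..<1} \<Longrightarrow> is_solution_P \<epsilon> lam mu (u \<epsilon>) (v \<epsilon>) (\<phi> \<epsilon>)"
    and reg_u: "\<And>\<epsilon>. \<epsilon> \<in> {0<..<1} \<Longrightarrow> C2a_interval \<alpha> (u \<epsilon>)"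
    and reg_v: "\<And>\<epsilon>. \<epsilon> \<in> {0<..<1} \<Longrightarrow> C2a_interval \<alpha> (v \<epsilon>)"
    and reg_phi: "\<And>\<epsilon>. \<epsilon> \<in> {0<..<1} \<Longrightarrow>
        W22 (Omega (u \<epsilon>) (v \<epsilon>)) (\<phi> \<epsilon>) \<and>
        continuous_on (closure (Omega (u \<epsilon>) (v \<epsilon>))) (\<phi> \<epsilon>) \<and>
        C2a_2d \<alpha> (Omega (u \<epsilon>) (v \<epsilon>) \<union> Gamma (u \<epsilon>) \<union> Gamma (v \<epsilon>)) (\<phi> \<epsilon>)"
    and even: "\<And>\<epsilon> x. \<epsilon> \<in> {0<..<1} \<Longrightarrow> x \<in> {-1..1} \<Longrightarrow>
        u \<epsilon> (-x) = u \<epsilon> x \<and> v \<epsilon> (-x) = v \<epsilon> x"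
    and even_phi: "\<And>\<epsilon> x z. \<epsilon> \<in> {0<..<1} \<Longrightarrow> (x, z) \<in> closure (Omega (u \<epsilon>) (v \<epsilon>)) \<Longrightarrow>
        \<phi> \<epsilon> (-x, z) = \<phi> \<epsilon> (x, z)"
    and convex: "\<And>\<epsilon>. \<epsilon> \<in> {0<..<1} \<Longrightarrow>
        convex_on {-1..1} (u \<epsilon>) \<and> convex_on {-1..1} (\<lambda>x. - v \<epsilon> x)"
    and second_bd: "\<And>\<epsilon> x. \<epsilon> \<in> {0<..<1} \<Longrightarrow> x \<in> {-1<..<1} \<Longrightarrow>
        \<bar>deriv (deriv (u \<epsilon>)) x\<bar> \<le> r0 \<and> \<bar>deriv (deriv (v \<epsilon>)) x\<bar> \<le> r0"
    and bounds: "\<And>\<epsilon> x. \<epsilon> \<in> {0<..<1} \<Longrightarrow> x \<in> {-1..1} \<Longrightarrow>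
        0 \<ge> u \<epsilon> x \<and> u \<epsilon> x \<ge> -1/3 + \<kappa>0 \<and> -1/3 - 2 * \<kappa>0 \<ge> v \<epsilon> x \<and> v \<epsilon> x \<ge> -1"
    and norm_bd: "\<And>\<epsilon>. \<epsilon> \<in> {0<..<1} \<Longrightarrow>
        W2inf_norm (u \<epsilon>) \<le> 3 \<and> W2inf_norm (v \<epsilon>) \<le> 3"
  shows "\<exists>(\<epsilon>k :: nat \<Rightarrow> real) u0 v0.
     (\<forall>k. \<epsilon>k k \<in> {0<..<1}) \<and> \<epsilon>k \<longlonglongrightarrow> 0 \<and>
     W2inf u0 \<and> W2inf v0 \<and>
     (\<forall>x\<in>{-1..1}. v0 x < u0 x) \<and>
     (\<forall>x\<in>{-1<..<1}. (deriv u0 has_real_derivative lam / (u0 x - v0 x)\<^sup>2) (at x)) \<and>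
     (\<forall>x\<in>{-1<..<1}. (deriv v0 has_real_derivative - mu / (u0 x - v0 x)\<^sup>2) (at x)) \<and>
     u0 (-1) = 0 \<and> u0 1 = 0 \<and> v0 (-1) = -1 \<and> v0 1 = -1 \<and>
     (\<forall>e>0. \<exists>N. \<forall>k\<ge>N. \<forall>x\<in>{-1<..<1}.
        \<bar>u (\<epsilon>k k) x - u0 x\<bar> \<le> e \<and> \<bar>deriv (u (\<epsilon>k k)) x - deriv u0 x\<bar> \<le> e \<and>
        \<bar>v (\<epsilon>k k) x - v0 x\<bar> \<le> e \<and> \<bar>deriv (v (\<epsilon>k k)) x - deriv v0 x\<bar> \<le> e) \<and>
     (let \<phi>0 = (\<lambda>(x, z). (z - v0 x) / (u0 x - v0 x));
          R = {-1<..<1} \<times> {-1<..<0};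
          D = (\<lambda>k p. \<phi> (\<epsilon>k k) p * indicator (Omega (u (\<epsilon>k k)) (v (\<epsilon>k k))) p
                     - \<phi>0 p * indicator (Omega u0 v0) p)
      in (\<forall>k. (\<lambda>p. (D k p)\<^sup>2) integrable_on R) \<and>
         (\<lambda>k. integral R (\<lambda>p. (D k p)\<^sup>2)) \<longlonglongrightarrow> 0)"
proof -
  \<comment> \<open>The offset 4 gives \<open>e n \<le> 1 / 4\<close>, whose square 1/16 is below
    the 1/10 that the barrier requires.\<close>
  define e where "e = (\<lambda>n. 1 / (real n + 4))"
  \<comment> \<open>The lower bound for \<open>u\<close> and the upper bound for \<open>v\<close>
    differ by exactly \<open>3 * \<kappa>0\<close>.\<close>
  define d where "d = 3 * \<kappa>0"
  have "0 < d"
    using kappa0 by (simp add: d_def)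
  have e_in: "e n \<in> {0<..<1}" for n
    by (simp add: e_def field_simps)
  have e_sq: "(e n)\<^sup>2 \<le> 1 / 10" for n
  proof -
    have "e n \<le> 1 / 4"
      by (simp add: e_def field_simps)
    then have "(e n)\<^sup>2 \<le> (1 / 4)\<^sup>2"
      using e_in[of n] by (intro power_mono) auto
    then show ?thesis
      by (simp add: power2_eq_square)
  qed
  have e_lim: "e \<longlonglongrightarrow> 0"
    using LIMSEQ_ignore_initial_segment[OF lim_1_over_n, of 4] by (simp add: e_def)
  have gap: "d \<le> u (e n) x - v (e n) x \<and> u (e n) x \<le> 0 \<and> -1 \<le> v (e n) x" if "x \<in> {-1..1}" for n x
    using bounds[OF e_in that, of n] by (auto simp: d_def)
  have second: "\<bar>deriv (deriv (u (e n))) x\<bar> \<le> 1 \<and> \<bar>deriv (deriv (v (e n))) x\<bar> \<le> 1" if "x \<in> {-1<..<1}" for n x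
    using second_bd[OF e_in that, of n] r0 by auto
  note est = solution_estimates[OF _ e_sq \<open>0 < d\<close> lam(1) mu(1) sol[OF e_in] reg_u[OF e_in] reg_v[OF e_in]
      _ _ second gap]
  have "\<forall>n. \<exists>u1 u2 v1 v2. C2_profile (u (e n)) u1 u2 \<and> C2_profile (v (e n)) v1 v2 \<and>
     (\<forall>x\<in>{-1<..<1}. \<bar>u2 x - lam / (u (e n) x - v (e n) x)\<^sup>2\<bar> \<le> lam * gradient_error d * (e n)\<^sup>2 \<and>
                    \<bar>v2 x - (- mu) / (u (e n) x - v (e n) x)\<^sup>2\<bar> \<le> mu * gradient_error d * (e n)\<^sup>2)"
    using est(1) e_in reg_phi[OF e_in] by auto
  then obtain u1 u2 v1 v2 where
    u: "\<And>n. C2_profile (u (e n)) (u1 n) (u2 n)" and v: "\<And>n. C2_profile (v (e n)) (v1 n) (v2 n)" and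
    u2: "\<And>n x. x \<in> {-1<..<1} \<Longrightarrow> \<bar>u2 n x - lam / (u (e n) x - v (e n) x)\<^sup>2\<bar> \<le> lam * gradient_error d * (e n)\<^sup>2" and
    v2: "\<And>n x. x \<in> {-1<..<1} \<Longrightarrow> \<bar>v2 n x - (- mu) / (u (e n) x - v (e n) x)\<^sup>2\<bar> \<le> mu * gradient_error d * (e n)\<^sup>2"
    by metis
  have close: "\<bar>\<phi> (e n) p - (snd p - v (e n) (fst p)) / (u (e n) (fst p) - v (e n) (fst p))\<bar> \<le> 52 / d^3 * (e n)\<^sup>2"
    if "p \<in> Omega (u (e n)) (v (e n))" for n p
    using est(2)[OF _ _ _ _ _ that] e_in reg_phi[OF e_in] by auto

  \<comment> \<open>Profiles and slopes are bundled into one map with values in a four-dimensional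
    space, so that a single subsequence serves all four.\<close>
  define F where "F = (\<lambda>n x. (u (e n) x, u1 n x, v (e n) x, v1 n x))"
  have norm4: "norm (a, b, c, d') \<le> \<bar>a\<bar> + \<bar>b\<bar> + \<bar>c\<bar> + \<bar>d'\<bar>" for a b c d' :: real
    using norm_Pair_le[of a "(b, c, d')"] norm_Pair_le[of b "(c, d')"] norm_Pair_le[of c d'] by simp
  obtain g r where "strict_mono (r :: nat \<Rightarrow> nat)" and
    g: "\<And>\<eta>. 0 < \<eta> \<Longrightarrow> \<exists>N. \<forall>n x. n \<ge> N \<and> x \<in> {-1..1} \<longrightarrow> norm (F (r n) x - g x) < \<eta>"
  \<comment> \<open>The bound 6 covers 1/3 + 2 + 1 + 2; the modulus \<open>\<eta> / 6\<close> below
    comes from the common Lipschitz constant 2 + 1 + 2 + 1.\<close>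
  proof (rule Arzela_Ascoli[of "{-1..1::real}" F 6])
    show "norm (F n x) \<le> 6" if "x \<in> {-1..1}" for n x
      using norm4[of "u (e n) x" "u1 n x" "v (e n) x" "v1 n x"] gap[OF that, of n] bounds[OF e_in that, of n] kappa0
        C2_profileD(4)[OF u that, of n] C2_profileD(4)[OF v that, of n] unfolding F_def by auto
    show "\<exists>\<delta>>0. \<forall>n y. y \<in> {-1..1} \<and> norm (x - y) < \<delta> \<longrightarrow> norm (F n x - F n y) < \<eta>"
      if x: "x \<in> {-1..1}" and "0 < \<eta>" for x \<eta>
    proof (intro exI[of _ "\<eta> / 6"] conjI allI impI)
      fix n y assume y: "y \<in> {-1..1} \<and> norm (x - y) < \<eta> / 6"
      then have yI: "y \<in> {-1..1}"
        by simp
      have "norm (F n x - F n y) \<le> 6 * \<bar>x - y\<bar>"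
        using norm4[of "u (e n) x - u (e n) y" "u1 n x - u1 n y" "v (e n) x - v (e n) y" "v1 n x - v1 n y"]
          C2_profileD(5,6)[OF u x yI, of n] C2_profileD(5,6)[OF v x yI, of n]
        unfolding F_def by simp
      then show "norm (F n x - F n y) < \<eta>"
        using y by simp
    qed (use \<open>0 < \<eta>\<close> in simp)
  qed auto
  define u0 where "u0 = (\<lambda>x. fst (g x))"
  define p0 where "p0 = (\<lambda>x. fst (snd (g x)))"
  define v0 where "v0 = (\<lambda>x. fst (snd (snd (g x))))"
  define q0 where "q0 = (\<lambda>x. snd (snd (snd (g x))))"
  have F_lim: "uniform_limit {-1..1} (\<lambda>n. F (r n)) g sequentially"
    unfolding uniform_limit_iff dist_norm eventually_sequentially using g by meson
  note fst_lim = bounded_linear.uniform_limit[OF bounded_linear_fst]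
    and snd_lim = bounded_linear.uniform_limit[OF bounded_linear_snd]
  note fst_lim[OF F_lim] fst_lim[OF snd_lim[OF F_lim]]
    fst_lim[OF snd_lim[OF snd_lim[OF F_lim]]] snd_lim[OF snd_lim[OF snd_lim[OF F_lim]]]
  then have ulim: "uniform_limit {-1..1} (\<lambda>n. u (e (r n))) u0 sequentially"
    "uniform_limit {-1..1} (\<lambda>n. u1 (r n)) p0 sequentially"
    "uniform_limit {-1..1} (\<lambda>n. v (e (r n))) v0 sequentially"
    "uniform_limit {-1..1} (\<lambda>n. v1 (r n)) q0 sequentially"
    by (simp_all add: F_def u0_def p0_def v0_def q0_def)
  have ptw: "(\<lambda>n. u (e (r n)) x) \<longlonglongrightarrow> u0 x" "(\<lambda>n. v (e (r n)) x) \<longlonglongrightarrow> v0 x" if "x \<in> {-1..1}" for x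
    using ulim that by (auto intro: tendsto_uniform_limitI)
  have gap0: "d \<le> u0 x - v0 x" "u0 x \<le> 0" "-1 \<le> v0 x" if "x \<in> {-1..1}" for x
  proof -
    show "d \<le> u0 x - v0 x"
      by (rule LIMSEQ_le_const[OF tendsto_diff[OF ptw[OF that]]]) (use gap[OF that] in auto)
    show "u0 x \<le> 0"
      by (rule LIMSEQ_le_const2[OF ptw(1)[OF that]]) (use gap[OF that] in auto)
    show "-1 \<le> v0 x"
      by (rule LIMSEQ_le_const[OF ptw(2)[OF that]]) (use gap[OF that] in auto)
  qed
  have er_lim: "(\<lambda>n. e (r n)) \<longlonglongrightarrow> 0"
    using LIMSEQ_subseq_LIMSEQ[OF e_lim \<open>strict_mono r\<close>] by (simp add: o_def)
  \<comment> \<open>Stated for a general numerator \<open>c\<close>, to be used with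
    \<open>lam\<close> and with \<open>- mu\<close>.\<close>
  have second_limit: "uniform_limit {-1<..<1} (\<lambda>n. w2 (r n)) (\<lambda>x. c / (u0 x - v0 x)\<^sup>2) sequentially"
    if w2: "\<And>n x. x \<in> {-1<..<1} \<Longrightarrow> \<bar>w2 n x - c / (u (e n) x - v (e n) x)\<^sup>2\<bar> \<le> B * (e n)\<^sup>2"
    for w2 c B
  proof (rule uniform_limitI)
    fix \<eta> :: real assume "0 < \<eta>"
    define L where "L = \<bar>c\<bar> * (2 / d^4)"
    have "0 \<le> L"
      using \<open>0 < d\<close> by (simp add: L_def)
    have "(\<lambda>n. B * (e (r n))\<^sup>2) \<longlonglongrightarrow> B * 0\<^sup>2"
      by (intro tendsto_intros er_lim)
    then have "\<forall>\<^sub>F n in sequentially. B * (e (r n))\<^sup>2 < \<eta> / 2"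
      using order_tendstoD(2)[of _ "B * 0\<^sup>2" _ "\<eta> / 2"] \<open>0 < \<eta>\<close> by simp
    \<comment> \<open>Half of \<open>\<eta>\<close> is spent on the error in the equation, the other
      half on the Lipschitz bound, where both profiles contribute. \<open>L + 1\<close> keeps the
      divisor positive when \<open>L = 0\<close>.\<close>
    moreover have "0 < \<eta> / (4 * (L + 1))"
      using \<open>0 < \<eta>\<close> \<open>0 \<le> L\<close> by simp
    note uniform_limitD[OF ulim(1) this] uniform_limitD[OF ulim(3) this]
    ultimately show "\<forall>\<^sub>F n in sequentially. \<forall>x\<in>{-1<..<1}. dist (w2 (r n) x) (c / (u0 x - v0 x)\<^sup>2) < \<eta>"
    proof eventually_elim
      case (elim n)
      show ?case
      proof
        fix x :: real assume x: "x \<in> {-1<..<1}"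
        then have xI: "x \<in> {-1..1}"
          by auto
        let ?D = "u (e (r n)) x - v (e (r n)) x"
        have "\<bar>1 / ?D\<^sup>2 - 1 / (u0 x - v0 x)\<^sup>2\<bar> \<le> 2 / d^4 * \<bar>?D - (u0 x - v0 x)\<bar>"
          by (rule inverse_square_diff_le[OF \<open>0 < d\<close>]) (use gap[OF xI, of "r n"] gap0[OF xI] in linarith)+
        from mult_left_mono[OF this abs_ge_zero[of c]]
        have "\<bar>c / ?D\<^sup>2 - c / (u0 x - v0 x)\<^sup>2\<bar> \<le> L * \<bar>?D - (u0 x - v0 x)\<bar>"
          by (simp add: L_def mult.assoc right_diff_distrib flip: abs_mult)
        also have "\<dots> \<le> L * (2 * (\<eta> / (4 * (L + 1))))"
        proof (rule mult_left_mono[OF _ \<open>0 \<le> L\<close>])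
          have "\<bar>u (e (r n)) x - u0 x\<bar> < \<eta> / (4 * (L + 1))" "\<bar>v (e (r n)) x - v0 x\<bar> < \<eta> / (4 * (L + 1))"
            using elim(2,3) xI by (auto simp: dist_real_def)
          then show "\<bar>?D - (u0 x - v0 x)\<bar> \<le> 2 * (\<eta> / (4 * (L + 1)))"
            by linarith
        qed
        also have "\<dots> \<le> \<eta> / 2"
          using \<open>0 \<le> L\<close> \<open>0 < \<eta>\<close> by (simp add: field_simps)
        finally show "dist (w2 (r n) x) (c / (u0 x - v0 x)\<^sup>2) < \<eta>"
          using w2[OF x, of "r n"] elim(1) unfolding dist_real_def by linarith
      qed
    qed
  qed
  have "uniform_limit {-1<..<1} (\<lambda>n. u2 (r n)) (\<lambda>x. lam / (u0 x - v0 x)\<^sup>2) sequentially"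
    "uniform_limit {-1<..<1} (\<lambda>n. v2 (r n)) (\<lambda>x. - mu / (u0 x - v0 x)\<^sup>2) sequentially"
    using second_limit[OF u2] second_limit[OF v2] by blast+
  note U = C2_profile_limit[OF u ulim(1,2) this(1)] and V = C2_profile_limit[OF v ulim(3,4) this(2)]
  have bvals: "u0 (-1) = 0" "u0 1 = 0" "v0 (-1) = -1" "v0 1 = -1"
  proof -
    have "u (e n) (-1) = 0" "u (e n) 1 = 0" "v (e n) (-1) = -1" "v (e n) 1 = -1" for n
      using sol[OF e_in] by (auto simp: is_solution_P_def Let_def)
    then show "u0 (-1) = 0" "u0 1 = 0" "v0 (-1) = -1" "v0 1 = -1"
      using ptw[of "-1"] ptw[of 1] by (auto simp: LIMSEQ_const_iff)
  qed
  have conv: "\<exists>N. \<forall>k\<ge>N. \<forall>x\<in>{-1<..<1}.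
        \<bar>u (e (r k)) x - u0 x\<bar> \<le> \<eta> \<and> \<bar>deriv (u (e (r k))) x - deriv u0 x\<bar> \<le> \<eta> \<and>
        \<bar>v (e (r k)) x - v0 x\<bar> \<le> \<eta> \<and> \<bar>deriv (v (e (r k))) x - deriv v0 x\<bar> \<le> \<eta>" if "\<eta> > 0" for \<eta>
  proof -
    have "\<forall>\<^sub>F k in sequentially. \<forall>x\<in>{-1<..<1}.
        \<bar>u (e (r k)) x - u0 x\<bar> \<le> \<eta> \<and> \<bar>deriv (u (e (r k))) x - deriv u0 x\<bar> \<le> \<eta> \<and>
        \<bar>v (e (r k)) x - v0 x\<bar> \<le> \<eta> \<and> \<bar>deriv (v (e (r k))) x - deriv v0 x\<bar> \<le> \<eta>"
      using ulim[THEN uniform_limitD, OF that]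
    proof eventually_elim
      case (elim k)
      show ?case
      proof
        fix x :: real assume x: "x \<in> {-1<..<1}"
        have "deriv (u (e (r k))) x = u1 (r k) x" "deriv (v (e (r k))) x = v1 (r k) x"
          using C2_profileD(1)[OF u x] C2_profileD(1)[OF v x] by (auto intro: DERIV_imp_deriv)
        moreover have "x \<in> {-1..1}"
          using x by auto
        ultimately show "\<bar>u (e (r k)) x - u0 x\<bar> \<le> \<eta> \<and> \<bar>deriv (u (e (r k))) x - deriv u0 x\<bar> \<le> \<eta> \<and>
            \<bar>v (e (r k)) x - v0 x\<bar> \<le> \<eta> \<and> \<bar>deriv (v (e (r k))) x - deriv v0 x\<bar> \<le> \<eta>"
          using elim U(3)[OF x] V(3)[OF x] by (auto simp: dist_real_def intro: less_imp_le)
      qed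
    qed
    then show ?thesis
      by (simp add: eventually_sequentially)
  qed
  have lt0: "v0 x < u0 x" if "x \<in> {-1..1}" for x
    using gap0(1)[OF that] \<open>0 < d\<close> by linarith
  \<comment> \<open>These errors play the role of \<open>\<delta>\<close> in
    \<open>potential_L2_limit\<close>, with \<open>M = 52 / d^3\<close>.\<close>
  have delta: "(\<lambda>k. 52 / d^3 * (e (r k))\<^sup>2) \<longlonglongrightarrow> 0" "0 \<le> 52 / d^3 * (e (r k))\<^sup>2" "52 / d^3 * (e (r k))\<^sup>2 \<le> 52 / d^3" for k
  proof -
    have "(\<lambda>k. 52 / d^3 * (e (r k))\<^sup>2) \<longlonglongrightarrow> 52 / d^3 * 0\<^sup>2"
      by (intro tendsto_intros er_lim)
    then show "(\<lambda>k. 52 / d^3 * (e (r k))\<^sup>2) \<longlonglongrightarrow> 0"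
      by simp
    have "(e (r k))\<^sup>2 \<le> 1"
      using e_sq[of "r k"] by simp
    then show "52 / d^3 * (e (r k))\<^sup>2 \<le> 52 / d^3"
      using \<open>0 < d\<close> by (intro mult_left_le) auto
  qed (use \<open>0 < d\<close> in simp)
  have Icc: "x \<in> {-1..1}" if "x \<in> {-1<..<1}" for x :: real
    using that by auto
  have c_open: "continuous_on {-1<..<1} (u (e n))" "continuous_on {-1<..<1} (v (e n))" for n
    using continuous_on_C2_profile[OF u, of n] continuous_on_C2_profile[OF v, of n] Icc
    by (meson continuous_on_subset subsetI)+
  have c_phi: "continuous_on (Omega (u (e n)) (v (e n))) (\<phi> (e n))" for n
    using reg_phi[OF e_in, of n] closure_subset continuous_on_subset by blast
  note L2 = potential_L2_limit[where u = "\<lambda>k. u (e (r k))" and v = "\<lambda>k. v (e (r k))" and \<phi> = "\<lambda>k. \<phi> (e (r k))",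
      OF ptw[OF Icc] c_open c_phi U(2) V(2) lt0[OF Icc] close delta]
  show ?thesis
    by (rule exI[of _ "\<lambda>k. e (r k)"], rule exI[of _ u0], rule exI[of _ v0])
       (use e_in er_lim U(1,4) V(1,4) lt0 bvals conv L2 in \<open>simp add: Let_def\<close>)
qed

end
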